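(* The minimum algebraic connectivity of connected cubic bipartite graphs on $2n$ vertices is $(1+o(1))\frac{\pi^{2}}{n^{2}}$ as $n\to\infty$. That is, if $m(n)$ denotes the minimum of $a(G)$ over all connected cubic bipartite graphs $G$ on $2n$ vertices, then $\lim_{n\to\infty} \frac{n^{2}}{\pi^{2}}\, m(n)=1$.
   Context: All graphs are finite, simple and undirected. A graph is cubic if every vertex has degree $3$. For a graph $G$ with adjacency matrix $A(G)$ and diagonal matrix of vertex degrees $D(G)$, the Laplacian matrix is $L(G)=D(G)-A(G)$. The algebraic connectivity $a(G)$ is the second smallest eigenvalue of $L(G)$ (counted with multiplicity). *)

theory Defs
  imports
    "HOL-Computational_Algebra.Polynomial"
    "HOL-Library.Multiset"
    "Graph_Theory.Pair_Digraph"
    "Graph_Theory.Digraph_Component"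
    "Jordan_Normal_Form.Char_Poly"
begin

text \<open>
  A finite simple undirected graph is a \<^locale>\<open>pair_graph\<close>: a finite symmetric loopless digraph
  without parallel arcs, each edge being represented by its two arcs.  Graphs with \<open>N\<close> vertices are
  taken on the vertex set \<open>{0..<N}\<close>, which loses nothing up to isomorphism and makes
  the vertices the row and column indices of the matrices below.
\<close>

definition vertex_degree :: "'a pair_pre_digraph \<Rightarrow> 'a \<Rightarrow> nat" where
  "vertex_degree G v = out_degree (with_proj G) v"

definition cubic :: "'a pair_pre_digraph \<Rightarrow> bool" where
  "cubic G \<longleftrightarrow> (\<forall>v \<in> pverts G. vertex_degree G v = 3)"

definition bipartite :: "'a pair_pre_digraph \<Rightarrow> bool" where
  "bipartite G \<longleftrightarrow> (\<exists>U W. pverts G = U \<union> W \<and> U \<inter> W = {} \<and>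
     (\<forall>(u, v) \<in> parcs G. (u \<in> U \<and> v \<in> W) \<or> (u \<in> W \<and> v \<in> U)))"

definition adjacency_mat :: "nat pair_pre_digraph \<Rightarrow> real mat" where
  "adjacency_mat G = mat (card (pverts G)) (card (pverts G))
     (\<lambda>(i, j). if (i, j) \<in> parcs G then 1 else 0)"

definition degree_mat :: "nat pair_pre_digraph \<Rightarrow> real mat" where
  "degree_mat G = mat (card (pverts G)) (card (pverts G))
     (\<lambda>(i, j). if i = j then real (vertex_degree G i) else 0)"

definition laplacian_mat :: "nat pair_pre_digraph \<Rightarrow> real mat" where
  "laplacian_mat G = degree_mat G - adjacency_mat G"

text \<open>
  The real roots of the characteristic polynomial with multiplicity, in increasing order.  A real
  symmetric matrix of dimension \<open>N\<close> has exactly \<open>N\<close> of them.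
\<close>

definition sorted_eigenvalues :: "real mat \<Rightarrow> real list" where
  "sorted_eigenvalues M = sorted_list_of_multiset (proots (char_poly M))"

text \<open>List indices start at 0, so index 1 is the second smallest eigenvalue.\<close>

definition algebraic_connectivity :: "nat pair_pre_digraph \<Rightarrow> real" where
  "algebraic_connectivity G = sorted_eigenvalues (laplacian_mat G) ! 1"

definition connected_cubic_bipartite_graphs :: "nat \<Rightarrow> nat pair_pre_digraph set" where
  "connected_cubic_bipartite_graphs N =
     {G. pair_graph G \<and> pverts G = {0..<N} \<and> Digraph_Component.connected (with_proj G)
         \<and> cubic G \<and> bipartite G}"

lemma finite_connected_cubic_bipartite_graphs:
  "finite (connected_cubic_bipartite_graphs N)"
proof (rule finite_subset)
  show "connected_cubic_bipartite_graphs N \<subseteq>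
      (\<lambda>E. \<lparr>pverts = {0..<N}, parcs = E\<rparr>) ` Pow ({0..<N} \<times> {0..<N})"
  proof
    fix G assume "G \<in> connected_cubic_bipartite_graphs N"
    then have G: "pair_graph G" and V: "pverts G = {0..<N}"
      by (auto simp: connected_cubic_bipartite_graphs_def)
    interpret pair_graph G by (fact G)
    have "parcs G \<subseteq> {0..<N} \<times> {0..<N}"
      using in_arcsD1 in_arcsD2 V by auto
    moreover have "G = \<lparr>pverts = {0..<N}, parcs = parcs G\<rparr>"
      using V by simp
    ultimately show "G \<in> (\<lambda>E. \<lparr>pverts = {0..<N}, parcs = E\<rparr>) ` Pow ({0..<N} \<times> {0..<N})"
      by blast
  qed
qed simp

text \<open>
  The minimum is over a finite set, nonempty for \<open>n \<ge> 3\<close>.  For \<open>n < 3\<close> there are no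
  such graphs and the value is unspecified, which does not affect limits as \<open>n\<close> tends to infinity.
\<close>

definition min_algebraic_connectivity :: "nat \<Rightarrow> real" where
  "min_algebraic_connectivity n =
     Min (algebraic_connectivity ` connected_cubic_bipartite_graphs (2 * n))"

end

theory Submission
  imports Defs
    "Jordan_Normal_Form.Spectral_Radius"
    "HOL-Combinatorics.Permutations"
    "HOL-Real_Asymp.Real_Asymp"
begin

text \<open>
The mechanism is a comparison with a path. Sort the vertices of a connected cubic bipartite graph by
the values of a vector \<open>x\<close>, so that edges become intervals between positions. Counting
edges from the two colour classes of a vertex set modulo 3 shows that no cut consists of a single
edge (\<open>cubic_bipartite_cut\<close>), so every gap between consecutive positions is crossed by
at least two edges. Treating each gap as if it had two edges of its own gives only half of the
bound. The other factor 2 comes from the degrees. Among the edges over a window of \<open>p\<close>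
consecutive gaps one can choose at most \<open>p + 1\<close> that still cross every gap of the
window twice (\<open>thrifty_double_cover\<close>), because two of them cannot end where two others
start; these edges have average length about 2. If \<open>d\<close> is the rise of \<open>x\<close>
over the window, the rises of the chosen edges, cut off to the window, sum to at least \<open>2
d\<close>, and by Cauchy--Schwarz the window carries energy at least \<open>4 d\<^sup>2 / (p +
1)\<close> (\<open>window_energy\<close>).

Energies of disjoint windows add up. Cutting the ordered vertex set at its middle position
\<open>n\<close> and comparing each half with a path of \<open>m\<close> blocks of length
\<open>p\<close> that is fixed at the middle and free at the outer end, a discrete Wirtinger
inequality gives \<open>\<Sum>(x i - x n)\<^sup>2 \<le> energy / path_bound p m\<close>
(\<open>two_sided_energy\<close>). If \<open>x\<close> has mean zero, the left side is at least
\<open>\<Sum>(x i)\<^sup>2\<close>, so \<open>path_bound p m\<close> is a lower bound for the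
algebraic connectivity. With \<open>p\<close> about \<open>sqrt n\<close> and \<open>m\<close> about
\<open>n / p\<close> it is asymptotic to \<open>pi\<^sup>2 / n\<^sup>2\<close>.

Equality holds to leading order for the ladder, which has two vertices per layer and two edges
between consecutive layers. Closing both ends by a copy of \<open>K\<^sub>3\<^sub>,\<^sub>3\<close>
minus an edge makes it cubic, and a half period of a cosine along its \<open>n - 6\<close> inner
layers, constant on the caps, shows that its algebraic connectivity is at most \<open>2 - 2 cos (pi
/ (n - 6))\<close> (\<open>algebraic_connectivity_capped_ladder_le\<close>).

Both estimates read the second entry of the sorted list of roots of the characteristic polynomial
through Rayleigh quotients. This is the Courant--Fischer principle, derived from the spectral
theorem for real symmetric matrices (\<open>orthogonal_diagonalization\<close>).
\<close>

section \<open>Twofold covers of the gaps of an ordered graph\<close>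

text \<open>
An edge \<open>(i, j)\<close> with \<open>i < j\<close> is an interval of positions; gap
\<open>k\<close> lies between positions \<open>k\<close> and \<open>k + 1\<close>.
\<close>

definition crossing :: "(nat \<times> nat) set \<Rightarrow> nat \<Rightarrow> (nat \<times> nat) set" where
  "crossing E k = {e \<in> E. fst e \<le> k \<and> k < snd e}"

lemma crossing_subset: "crossing E k \<subseteq> E"
  by (auto simp: crossing_def)

lemma crossing_mono: "H \<subseteq> E \<Longrightarrow> crossing H k \<subseteq> crossing E k"
  by (auto simp: crossing_def)

lemma finite_farthest:
  fixes C :: "(nat \<times> nat) set"
  assumes "finite C" "C \<noteq> {}"
  obtains f where "f \<in> C" "\<And>e. e \<in> C \<Longrightarrow> snd e \<le> snd f"
proof -
  have "Max (snd ` C) \<in> snd ` C" using assms by (intro Max_in) auto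
  then obtain f where "f \<in> C" "snd f = Max (snd ` C)" by auto
  with assms that show ?thesis by (metis Max_ge finite_imageI imageI)
qed

text \<open>
The cover is built greedily from left to right, adding the farthest-reaching edges whenever a gap is
crossed fewer than twice. Each new gap may cost one edge. The danger is a gap at which both current
edges end, so that two are needed. The invariant is that the budget is exceeded by at most one, and
if it is, the cover contains a farthest-reaching edge over the current gap. Then two edges cannot
both be missing: all edges over the old gap would end at the vertex \<open>k\<close> in between, and
all edges over the new gap would start there, which gives \<open>k\<close> degree at least 4. Gaps
from \<open>K\<close> on impose no condition, so that a window may stick out beyond the last vertex.
\<close>

lemma thrifty_double_cover:
  assumes fin: "finite E"
    and deg: "\<And>v. card {e \<in> E. fst e = v \<or> snd e = v} \<le> 3"
    and cut: "\<And>k. k < K \<Longrightarrow> 2 \<le> card (crossing E k)"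
  shows "\<exists>H\<subseteq>E. card H \<le> q + 2 \<and> (\<forall>k\<in>{a..a+q}. k < K \<longrightarrow> 2 \<le> card (crossing H k))"
proof -
  have finC: "finite (crossing H k)" if "H \<subseteq> E" for H k
    using that fin crossing_subset finite_subset by metis
  have "\<exists>H\<subseteq>E. (\<forall>k\<in>{a..a+q}. k < K \<longrightarrow> 2 \<le> card (crossing H k)) \<and>
      (card H \<le> q + 1 \<or>
       card H = q + 2 \<and> (\<exists>f \<in> crossing H (a+q). \<forall>e \<in> crossing E (a+q). snd e \<le> snd f))"
  proof (induction q)
    case 0
    show ?case
    proof (cases "a < K")
      case True
      then have two: "2 \<le> card (crossing E a)" by (rule cut)
      then have "crossing E a \<noteq> {}" by auto
      with finC[of E] obtain f where f: "f \<in> crossing E a" "\<And>e. e \<in> crossing E a \<Longrightarrow> snd e \<le> snd f"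
        using finite_farthest by blast
      have "\<not> crossing E a \<subseteq> {f}"
        using two card_mono[of "{f}" "crossing E a"] by auto
      then obtain g where g: "g \<in> crossing E a" "g \<noteq> f" by auto
      have "crossing {f, g} a = {f, g}" using f g by (auto simp: crossing_def)
      moreover have "card {f, g} = 2" using g by auto
      moreover have "{f, g} \<subseteq> E" using f g crossing_subset by blast
      ultimately show ?thesis using f by (intro exI[of _ "{f, g}"]) auto
    next
      case False
      then show ?thesis by (intro exI[of _ "{}"]) auto
    qed
  next
    case (Suc q)
    then obtain H where H: "H \<subseteq> E" "\<And>k. k \<in> {a..a+q} \<Longrightarrow> k < K \<Longrightarrow> 2 \<le> card (crossing H k)"
      and cardH: "card H \<le> q + 1 \<or>
       card H = q + 2 \<and> (\<exists>f \<in> crossing H (a+q). \<forall>e \<in> crossing E (a+q). snd e \<le> snd f)"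
      by blast
    define k where "k = a + Suc q"
    have range: "{a..a + Suc q} = insert k {a..a+q}" by (auto simp: k_def)
    have finH: "finite H" using H(1) fin finite_subset by blast
    have cover_mono: "2 \<le> card (crossing H' j)" if "H \<subseteq> H'" "H' \<subseteq> E" "j \<in> {a..a+q}" "j < K" for H' j
      using card_mono[OF finC[OF that(2)] crossing_mono[OF that(1)]] H(2)[OF that(3,4)]
      by (rule le_trans[rotated])
    show ?case
    proof (cases "k < K \<longrightarrow> 2 \<le> card (crossing H k)")
      case True
      then show ?thesis using H cardH unfolding range by (intro exI[of _ H]) auto
    next
      case False
      then have kK: "k < K" and less: "card (crossing H k) < 2" by auto
      have two: "2 \<le> card (crossing E k)" by (rule cut[OF kK])
      show ?thesis
      proof (cases "crossing H k = {}")
        case False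
        then have one: "card (crossing H k) = 1"
          using less finC[OF H(1)] by (metis One_nat_def card_gt_0_iff less_2_cases less_numeral_extra(3))
        have "\<not> crossing E k \<subseteq> crossing H k"
          using two less card_mono[OF finC[OF H(1)], of "crossing E k" k] by auto
        then have "crossing E k - H \<noteq> {}" by (auto simp: crossing_def)
        then obtain e where e: "e \<in> crossing E k - H"
            "\<And>e'. e' \<in> crossing E k - H \<Longrightarrow> snd e' \<le> snd e"
          using finite_farthest[of "crossing E k - H"] finC[of E] by auto
        let ?H = "insert e H"
        have sub: "?H \<subseteq> E" using e H crossing_subset by blast
        have cr: "crossing ?H k = insert e (crossing H k)" using e by (auto simp: crossing_def)
        have "e \<notin> crossing H k" using e crossing_subset by blast
        then have c2: "card (crossing ?H k) = 2" unfolding cr using one finC[OF H(1)] by simp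
        have cov: "2 \<le> card (crossing ?H j)" if "j \<in> {a..k}" "j < K" for j
          using that c2 cover_mono[of ?H j] sub by (cases "j = k") (auto simp: k_def)
        have cardi: "card ?H = card H + 1" using e finH by simp
        have far: "\<exists>f \<in> crossing ?H k. \<forall>e \<in> crossing E k. snd e \<le> snd f"
        proof -
          have "crossing E k \<noteq> {}" using two by auto
          then obtain f where f: "f \<in> crossing E k" "\<And>e. e \<in> crossing E k \<Longrightarrow> snd e \<le> snd f"
            using finite_farthest[of "crossing E k"] finC[of E] by auto
          show ?thesis
          proof (cases "f \<in> H")
            case True
            then have "f \<in> crossing ?H k" using f by (auto simp: crossing_def)
            then show ?thesis using f by blast
          next
            case False
            then have "snd f \<le> snd e" using e f by blast
            then show ?thesis using f(2) cr by (metis insertI1 le_trans)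
          qed
        qed
        show ?thesis
          using sub cov cardi cardH far unfolding k_def[symmetric]
          by (intro exI[of _ ?H]) auto
      next
        case True
        \<comment> \<open>Two edges are needed here; the degree bound at \<open>k\<close> shows that the budget is not exceeded so far.\<close>
        have slack: "card H \<le> q + 1"
        proof (rule ccontr)
          assume "\<not> ?thesis"
          with cardH obtain f where f: "f \<in> crossing H (a+q)"
            "\<And>e. e \<in> crossing E (a+q) \<Longrightarrow> snd e \<le> snd f" by auto
          have sndk: "snd e = k" if "e \<in> crossing H (a+q)" for e
          proof -
            have "e \<notin> crossing H k" using True by simp
            then show ?thesis using that by (auto simp: crossing_def k_def)
          qed
          have fstk: "fst e = k" if "e \<in> crossing E k" for e
          proof (rule ccontr)
            assume "fst e \<noteq> k"
            then have "e \<in> crossing E (a+q)" using that by (auto simp: crossing_def k_def)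
            then have "snd e \<le> k" using f sndk by metis
            then show False using that by (auto simp: crossing_def)
          qed
          have "a + q \<in> {a..a+q}" "a + q < K" using kK by (auto simp: k_def)
          then have "2 \<le> card (crossing H (a+q))" by (rule H)
          moreover have "crossing H (a+q) \<inter> crossing E k = {}"
          proof -
            have False if "e \<in> crossing H (a+q)" "e \<in> crossing E k" for e
              using fstk[OF that(2)] that(1) by (auto simp: crossing_def k_def)
            then show ?thesis by blast
          qed
          ultimately have "4 \<le> card (crossing H (a+q) \<union> crossing E k)"
            using two finC[OF H(1)] finC[of E] by (subst card_Un_disjoint) auto
          also have "\<dots> \<le> card {e \<in> E. fst e = k \<or> snd e = k}"
          proof (rule card_mono)
            have "e \<in> E" if "e \<in> crossing H (a+q) \<union> crossing E k" for e
              using that H(1) crossing_subset by blast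
            then show "crossing H (a+q) \<union> crossing E k \<subseteq> {e \<in> E. fst e = k \<or> snd e = k}"
              using fstk sndk by blast
          qed (use fin in simp)
          also have "\<dots> \<le> 3" by (rule deg)
          finally show False by simp
        qed
        have "crossing E k \<noteq> {}" using two by auto
        then obtain f where f: "f \<in> crossing E k" "\<And>e. e \<in> crossing E k \<Longrightarrow> snd e \<le> snd f"
          using finite_farthest[of "crossing E k"] finC[of E] by auto
        have "\<not> crossing E k \<subseteq> {f}"
          using two card_mono[of "{f}" "crossing E k"] by auto
        then obtain g where g: "g \<in> crossing E k" "g \<noteq> f" by auto
        let ?H = "insert f (insert g H)"
        have sub: "?H \<subseteq> E" using f g H crossing_subset by blast
        have "f \<notin> H" "g \<notin> H" using f g True by (auto simp: crossing_def)
        then have cardi: "card ?H = card H + 2" using g finH by simp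
        have cr: "crossing ?H k = {f, g}" using f g True by (auto simp: crossing_def)
        then have c2: "card (crossing ?H k) = 2" using g by simp
        have cov: "2 \<le> card (crossing ?H j)" if "j \<in> {a..k}" "j < K" for j
          using that c2 cover_mono[of ?H j] sub by (cases "j = k") (auto simp: k_def)
        show ?thesis
          using sub cov cardi slack f(2) cr unfolding k_def[symmetric]
          by (intro exI[of _ ?H]) auto
      qed
    qed
  qed
  then show ?thesis by (metis Suc_eq_plus1 add_2_eq_Suc' le_SucI order_refl)
qed

section \<open>Dirichlet energy of a monotone function\<close>

text \<open>
Moving positions into the window \<open>[a, b]\<close>: for monotone \<open>x\<close>, the value at
the clamped position is the value of \<open>x\<close> truncated to \<open>[x a, x b]\<close>.
\<close>

definition clamp :: "nat \<Rightarrow> nat \<Rightarrow> nat \<Rightarrow> nat" where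
  "clamp a b i = max a (min b i)"

lemma clamped_rise_eq_sum:
  fixes x :: "nat \<Rightarrow> real"
  assumes "i \<le> j"
  shows "x (clamp a b j) - x (clamp a b i) =
    (\<Sum>k\<in>{a..<b}. if i \<le> k \<and> k < j then x (Suc k) - x k else 0)"
proof -
  have "clamp a b i \<le> clamp a b j" using assms by (auto simp: clamp_def)
  then have "x (clamp a b j) - x (clamp a b i) = (\<Sum>k = clamp a b i..<clamp a b j. x (Suc k) - x k)"
    by (rule sum_Suc_diff'[symmetric])
  also have "{clamp a b i..<clamp a b j} = {k \<in> {a..<b}. i \<le> k \<and> k < j}"
    by (auto simp: clamp_def)
  also have "(\<Sum>k\<in>\<dots>. x (Suc k) - x k) =
      (\<Sum>k\<in>{a..<b}. if i \<le> k \<and> k < j then x (Suc k) - x k else 0)"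
    by (rule sum.inter_filter) simp
  finally show ?thesis .
qed

text \<open>
The rises of the edges of a thrifty double cover, truncated to the window, sum to at least twice the
rise of \<open>x\<close> over the window. There are at most \<open>p + 1\<close> of them, so
Cauchy--Schwarz bounds the sum of their squares from below.
\<close>

lemma window_energy:
  fixes x :: "nat \<Rightarrow> real"
  assumes fin: "finite E"
    and ord: "\<And>e. e \<in> E \<Longrightarrow> fst e < snd e"
    and deg: "\<And>v. card {e \<in> E. fst e = v \<or> snd e = v} \<le> 3"
    and cut: "\<And>k. k < K \<Longrightarrow> 2 \<le> card (crossing E k)"
    and mono: "mono x"
    and const: "\<And>k. K \<le> k \<Longrightarrow> x k = x K"
    and p: "1 \<le> p"
  shows "4 * (x (a + p) - x a)\<^sup>2 / real (p + 1) \<le>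
    (\<Sum>e\<in>E. (x (clamp a (a+p) (snd e)) - x (clamp a (a+p) (fst e)))\<^sup>2)"
proof -
  let ?b = "a + p"
  define t where "t e = x (clamp a ?b (snd e)) - x (clamp a ?b (fst e))" for e
  define d where "d = x ?b - x a"
  define \<delta> where "\<delta> k = x (Suc k) - x k" for k
  have step: "0 \<le> \<delta> k" for k using mono by (simp add: mono_def \<delta>_def)
  have d0: "0 \<le> d" using mono by (simp add: mono_def d_def)
  obtain H where H: "H \<subseteq> E" "card H \<le> p + 1"
    and cov: "\<And>k. k \<in> {a..<?b} \<Longrightarrow> k < K \<Longrightarrow> 2 \<le> card (crossing H k)"
  proof -
    have "{a..a + (p - 1)} = {a..<a + p}" using p by auto
    then show ?thesis
      using thrifty_double_cover[OF fin deg cut, of K "p - 1" a] p that by auto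
  qed
  have finH: "finite H" using H(1) fin finite_subset by blast
  have "2 * d = (\<Sum>k\<in>{a..<?b}. 2 * \<delta> k)"
    unfolding d_def \<delta>_def sum_distrib_left[symmetric] by (subst sum_Suc_diff') auto
  also have "\<dots> \<le> (\<Sum>k\<in>{a..<?b}. real (card (crossing H k)) * \<delta> k)"
  proof (rule sum_mono)
    fix k assume k: "k \<in> {a..<?b}"
    show "2 * \<delta> k \<le> real (card (crossing H k)) * \<delta> k"
    proof (cases "k < K")
      case True
      then have "2 \<le> card (crossing H k)" using cov k by blast
      then show ?thesis using step by (intro mult_right_mono) auto
    next
      case False
      then have "\<delta> k = 0" using const[of k] const[of "Suc k"] by (simp add: \<delta>_def)
      then show ?thesis by simp
    qed
  qed
  also have "\<dots> = (\<Sum>k\<in>{a..<?b}. \<Sum>e\<in>H. if fst e \<le> k \<and> k < snd e then \<delta> k else 0)"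
    by (rule sum.cong) (simp_all add: crossing_def finH sum.inter_filter[symmetric])
  also have "\<dots> = (\<Sum>e\<in>H. \<Sum>k\<in>{a..<?b}. if fst e \<le> k \<and> k < snd e then \<delta> k else 0)"
    by (rule sum.swap)
  also have "\<dots> = (\<Sum>e\<in>H. t e)"
  proof (rule sum.cong[OF refl])
    fix e assume "e \<in> H"
    then have "fst e \<le> snd e" using ord H(1) by (simp add: less_imp_le subsetD)
    from clamped_rise_eq_sum[OF this, of x a ?b]
    show "(\<Sum>k\<in>{a..<?b}. if fst e \<le> k \<and> k < snd e then \<delta> k else 0) = t e"
      unfolding t_def \<delta>_def by simp
  qed
  finally have sumt: "2 * d \<le> (\<Sum>e\<in>H. t e)" .
  \<comment> \<open>Cauchy--Schwarz, as nonnegativity of the variance around the extremal common rise.\<close>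
  define c where "c = 2 * d / real (p + 1)"
  have c0: "0 \<le> c" using d0 by (simp add: c_def)
  have cp: "c * real (p + 1) = 2 * d" by (simp add: c_def)
  have "0 \<le> (\<Sum>e\<in>H. (t e - c)\<^sup>2)" by (rule sum_nonneg) simp
  also have "\<dots> = (\<Sum>e\<in>H. (t e)\<^sup>2) - 2 * c * (\<Sum>e\<in>H. t e) + c\<^sup>2 * real (card H)"
    by (simp add: power2_diff sum.distrib sum_subtractf sum_distrib_left sum_distrib_right mult_ac)
  also have "\<dots> \<le> (\<Sum>e\<in>H. (t e)\<^sup>2) - 2 * c * (2 * d) + c\<^sup>2 * real (p + 1)"
  proof -
    have "2 * c * (2 * d) \<le> 2 * c * (\<Sum>e\<in>H. t e)" using sumt c0 by (intro mult_left_mono) auto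
    moreover have "c\<^sup>2 * real (card H) \<le> c\<^sup>2 * real (p + 1)"
      using H(2) by (intro mult_left_mono) auto
    ultimately show ?thesis by linarith
  qed
  also have "c\<^sup>2 * real (p + 1) = c * (2 * d)" by (simp add: power2_eq_square cp[symmetric])
  finally have "2 * c * d \<le> (\<Sum>e\<in>H. (t e)\<^sup>2)" by (simp add: algebra_simps)
  also have "\<dots> \<le> (\<Sum>e\<in>E. (t e)\<^sup>2)" by (rule sum_mono2[OF fin H(1)]) simp
  also have "2 * c * d = 4 * d\<^sup>2 / real (p + 1)" by (simp add: c_def power2_eq_square)
  finally show ?thesis by (simp only: t_def d_def)
qed

lemma clamped_rises_telescope:
  fixes x :: "nat \<Rightarrow> real"
  shows "(\<Sum>w<m. x (clamp (s + w*p) (s + w*p + p) i) - x (s + w*p)) = x (clamp s (s + m*p) i) - x s"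
proof (induction m)
  case 0
  show ?case by (simp add: clamp_def)
next
  case (Suc m)
  have "x (clamp s (s + m*p) i) + (x (clamp (s + m*p) (s + m*p + p) i) - x (s + m*p)) =
      x (clamp s (s + Suc m*p) i)"
    by (cases "i \<le> s + m * p") (auto simp: clamp_def min_def max_def algebra_simps)
  then show ?case using Suc by simp
qed

lemma sum_of_squares_le_square_of_sum:
  fixes f :: "'a \<Rightarrow> real"
  assumes "finite A" "\<And>a. a \<in> A \<Longrightarrow> 0 \<le> f a"
  shows "(\<Sum>a\<in>A. (f a)\<^sup>2) \<le> (\<Sum>a\<in>A. f a)\<^sup>2"
  using assms
proof (induction A rule: finite_induct)
  case (insert a A)
  then have "0 \<le> 2 * f a * (\<Sum>a\<in>A. f a)" by (simp add: sum_nonneg)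
  then show ?case using insert by (simp add: power2_sum)
qed simp

text \<open>
The rise of one edge splits into its rises within consecutive windows, which are all nonnegative, so
one edge pays for all windows that it meets.
\<close>

lemma windows_superadditive:
  fixes x :: "nat \<Rightarrow> real"
  assumes mono: "mono x" and ij: "i \<le> j"
  shows "(\<Sum>w<m. (x (clamp (s + w*p) (s + w*p + p) j) - x (clamp (s + w*p) (s + w*p + p) i))\<^sup>2)
     \<le> (x (max s j) - x (max s i))\<^sup>2"
proof -
  let ?c = "\<lambda>w. clamp (s + w*p) (s + w*p + p)"
  have le: "x (clamp a b i) \<le> x (clamp a b j)" for a b
    using ij by (intro monoD[OF mono]) (auto simp: clamp_def)
  have "(\<Sum>w<m. (x (?c w j) - x (?c w i))\<^sup>2) \<le> (\<Sum>w<m. x (?c w j) - x (?c w i))\<^sup>2"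
    using le by (intro sum_of_squares_le_square_of_sum) auto
  also have "(\<Sum>w<m. x (?c w j) - x (?c w i)) = x (clamp s (s+m*p) j) - x (clamp s (s+m*p) i)"
    using clamped_rises_telescope[of x s p j m] clamped_rises_telescope[of x s p i m]
    by (simp add: sum_subtractf)
  also have "\<dots>\<^sup>2 \<le> (x (max s j) - x (max s i))\<^sup>2"
  proof (rule power_mono)
    show "x (clamp s (s+m*p) j) - x (clamp s (s+m*p) i) \<le> x (max s j) - x (max s i)"
    proof (cases "i \<le> s + m*p")
      case True
      then have "clamp s (s+m*p) i = max s i" by (simp add: clamp_def)
      moreover have "x (clamp s (s+m*p) j) \<le> x (max s j)"
        by (rule monoD[OF mono]) (auto simp: clamp_def)
      ultimately show ?thesis by simp
    next
      case False
      then have "clamp s (s+m*p) i = clamp s (s+m*p) j" using ij by (simp add: clamp_def)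
      moreover have "x (max s i) \<le> x (max s j)" using ij by (intro monoD[OF mono]) auto
      ultimately show ?thesis by simp
    qed
  qed (use le in auto)
  finally show ?thesis .
qed

text \<open>
The function \<open>\<phi> j = sin (j \<theta>)\<close> vanishes at \<open>0\<close>, satisfies the
eigenvalue equation of the path, and has \<open>\<phi> (m + 1) = \<phi> m\<close> for this
\<open>\<theta>\<close>, which is the condition for a free end. The inequality follows from its
positivity by Picone's argument: the arithmetic-geometric mean inequality with weights \<open>\<phi>
(j + 1) / \<phi> j\<close> is applied to each product \<open>z j * z (j + 1)\<close>, and the
weights telescope.
\<close>

lemma discrete_wirtinger:
  fixes z :: "nat \<Rightarrow> real"
  assumes z0: "z 0 = 0" and m: "1 \<le> m"
  defines "\<theta> \<equiv> pi / real (2 * m + 1)"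
  shows "(2 - 2 * cos \<theta>) * (\<Sum>j=1..m. (z j)\<^sup>2) \<le> (\<Sum>j<m. (z (Suc j) - z j)\<^sup>2)"
proof -
  define \<phi> where "\<phi> j = sin (real j * \<theta>)" for j
  have pos: "0 < \<phi> j" if "1 \<le> j" "j \<le> m" for j
  proof -
    have "real j * pi < real (2 * m + 1) * pi"
      using that by (intro mult_strict_right_mono) auto
    then have "real j * \<theta> < pi" by (simp add: \<theta>_def field_simps)
    then show ?thesis using that by (auto simp: \<phi>_def \<theta>_def intro!: sin_gt_zero)
  qed
  have rec: "\<phi> (Suc (Suc j)) = 2 * cos \<theta> * \<phi> (Suc j) - \<phi> j" for j
  proof -
    have "\<phi> (Suc (Suc j)) + \<phi> j = sin (real (Suc j) * \<theta> + \<theta>) + sin (real (Suc j) * \<theta> - \<theta>)"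
      by (simp add: \<phi>_def algebra_simps)
    then show ?thesis by (simp add: sin_add sin_diff \<phi>_def)
  qed
  have free_end: "\<phi> (Suc m) = \<phi> m"
  proof -
    have "real (Suc m) * \<theta> = pi - real m * \<theta>" by (simp add: \<theta>_def field_simps)
    then show ?thesis by (simp add: \<phi>_def)
  qed
  have partial: "l \<le> m \<Longrightarrow> 1 \<le> l \<Longrightarrow> (2 - 2 * cos \<theta>) * (\<Sum>j=1..l. (z j)\<^sup>2) + (\<phi> (Suc l) / \<phi> l - 1) * (z l)\<^sup>2
      \<le> (\<Sum>j<l. (z (Suc j) - z j)\<^sup>2)" for l
  proof (induction l)
    case (Suc l)
    show ?case
    proof (cases "l = 0")
      case True
      have "\<phi> 2 = 2 * cos \<theta> * \<phi> 1" using rec[of 0] by (simp add: \<phi>_def numeral_2_eq_2)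
      then have "\<phi> (Suc (Suc 0)) / \<phi> (Suc 0) = 2 * cos \<theta>" using pos[of 1] m by (simp add: numeral_2_eq_2)
      then show ?thesis using z0 True by (simp add: algebra_simps)
    next
      case False
      define r where "r = \<phi> (Suc l) / \<phi> l"
      have p1: "0 < \<phi> l" "0 < \<phi> (Suc l)" using pos[of l] pos[of "Suc l"] False Suc.prems by auto
      then have r: "0 < r" by (simp add: r_def)
      have q: "\<phi> (Suc (Suc l)) / \<phi> (Suc l) = 2 * cos \<theta> - 1 / r"
        using p1 rec[of l] by (simp add: r_def field_simps)
      have "0 \<le> (r * z l - z (Suc l))\<^sup>2 / r" using r by simp
      also have "\<dots> = r * (z l)\<^sup>2 - 2 * z l * z (Suc l) + (z (Suc l))\<^sup>2 / r"
        using r by (simp add: power2_diff power2_eq_square field_simps)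
      finally have amgm: "2 * z l * z (Suc l) \<le> r * (z l)\<^sup>2 + (z (Suc l))\<^sup>2 / r" by simp
      have IH: "(2 - 2 * cos \<theta>) * (\<Sum>j=1..l. (z j)\<^sup>2) + (r - 1) * (z l)\<^sup>2 \<le> (\<Sum>j<l. (z (Suc j) - z j)\<^sup>2)"
        using Suc.IH Suc.prems False by (simp add: r_def)
      have "(2 - 2 * cos \<theta>) * (\<Sum>j=1..Suc l. (z j)\<^sup>2) + (2 * cos \<theta> - 1 / r - 1) * (z (Suc l))\<^sup>2 =
          (2 - 2 * cos \<theta>) * (\<Sum>j=1..l. (z j)\<^sup>2) + (z (Suc l))\<^sup>2 - (z (Suc l))\<^sup>2 / r"
        by (simp add: algebra_simps)
      also have "\<dots> \<le> (\<Sum>j<l. (z (Suc j) - z j)\<^sup>2) + (z (Suc l) - z l)\<^sup>2"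
        using IH amgm by (simp add: power2_diff algebra_simps)
      finally show ?thesis unfolding q by simp
    qed
  qed simp
  from partial[of m] m free_end pos[of m] show ?thesis by simp
qed

text \<open>
The lowest eigenvalue of a path of \<open>m\<close> blocks, fixed at one end and free at the other,
where each block stands for \<open>p\<close> vertices (mass \<open>p\<close>) and has conductance
\<open>4 / (p + 1)\<close>.
\<close>

definition path_bound :: "nat \<Rightarrow> nat \<Rightarrow> real" where
  "path_bound p m = (2 - 2 * cos (pi / real (2*m + 1))) * 4 / (real p * real (p+1))"

lemma path_bound_nonneg: "0 \<le> path_bound p m"
  by (simp add: path_bound_def)

text \<open>
The values \<open>x (s + j p)\<close> at the block boundaries are compared with the path. Because
\<open>x\<close> is monotone, the last value in a block dominates all the others, so passing from
vertices to blocks costs no error term.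
\<close>

lemma upper_half_energy:
  fixes x :: "nat \<Rightarrow> real"
  assumes fin: "finite E"
    and ord: "\<And>e. e \<in> E \<Longrightarrow> fst e < snd e"
    and deg: "\<And>v. card {e \<in> E. fst e = v \<or> snd e = v} \<le> 3"
    and cut: "\<And>k. k < K \<Longrightarrow> 2 \<le> card (crossing E k)"
    and mono: "mono x"
    and const: "\<And>k. K \<le> k \<Longrightarrow> x k = x K"
    and p: "1 \<le> p" and m: "1 \<le> m" and K: "K \<le> s + m * p"
  shows "path_bound p m * (\<Sum>i=s..K. (x i - x s)\<^sup>2)
     \<le> (\<Sum>e\<in>E. (x (max s (snd e)) - x (max s (fst e)))\<^sup>2)"
proof -
  define z where "z j = x (s + j*p) - x s" for j
  have z0: "z 0 = 0" by (simp add: z_def)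
  let ?l = "2 - 2 * cos (pi / real (2 * m + 1))"
  have l0: "0 \<le> ?l" by simp
  have block: "(\<Sum>i=s+1..s + m*p. (x i - x s)\<^sup>2) \<le> (\<Sum>j=1..m. real p * (z j)\<^sup>2)" for m
  proof (induction m)
    case (Suc m)
    have "{s+1..s + Suc m * p} = {s+1..s+m*p} \<union> {s+m*p+1..s+Suc m*p}" by auto
    then have "(\<Sum>i=s+1..s + Suc m*p. (x i - x s)\<^sup>2) =
        (\<Sum>i=s+1..s + m*p. (x i - x s)\<^sup>2) + (\<Sum>i=s+m*p+1..s + Suc m*p. (x i - x s)\<^sup>2)"
      by (simp only:) (rule sum.union_disjoint, auto)
    also have "(\<Sum>i=s+m*p+1..s + Suc m*p. (x i - x s)\<^sup>2) \<le> (\<Sum>i=s+m*p+1..s + Suc m*p. (z (Suc m))\<^sup>2)"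
    proof (rule sum_mono)
      fix i assume i: "i \<in> {s+m*p+1..s + Suc m*p}"
      then have "s \<le> i" by simp
      then have "x s \<le> x i" "x i \<le> x (s + Suc m * p)" using i by (auto intro: monoD[OF mono])
      then show "(x i - x s)\<^sup>2 \<le> (z (Suc m))\<^sup>2" unfolding z_def by (intro power_mono) auto
    qed
    also have "\<dots> = real p * (z (Suc m))\<^sup>2" by simp
    finally show ?case using Suc by simp
  qed simp
  have "?l * (\<Sum>i=s..K. (x i - x s)\<^sup>2) \<le> ?l * (\<Sum>i=s..s+m*p. (x i - x s)\<^sup>2)"
    using K by (intro mult_left_mono[OF _ l0] sum_mono2) auto
  also have "(\<Sum>i=s..s+m*p. (x i - x s)\<^sup>2) = (\<Sum>i=s+1..s+m*p. (x i - x s)\<^sup>2)"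
    by (subst sum.atLeast_Suc_atMost) auto
  also have "?l * \<dots> \<le> ?l * (real p * (\<Sum>j=1..m. (z j)\<^sup>2))"
    using block[of m] by (intro mult_left_mono[OF _ l0]) (simp add: sum_distrib_left)
  also have "\<dots> = real p * (?l * (\<Sum>j=1..m. (z j)\<^sup>2))" by simp
  also have "\<dots> \<le> real p * (\<Sum>w<m. (z (Suc w) - z w)\<^sup>2)"
    by (intro mult_left_mono discrete_wirtinger[of z m, OF z0 m]) simp
  finally have 1: "?l * (\<Sum>i=s..K. (x i - x s)\<^sup>2) \<le> real p * (\<Sum>w<m. (z (Suc w) - z w)\<^sup>2)" .
  let ?c = "\<lambda>w. clamp (s + w*p) (s + w*p + p)"
  have "(\<Sum>w<m. 4 * (z (Suc w) - z w)\<^sup>2 / real (p+1)) \<le>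
      (\<Sum>w<m. \<Sum>e\<in>E. (x (?c w (snd e)) - x (?c w (fst e)))\<^sup>2)"
  proof (rule sum_mono)
    fix w
    show "4 * (z (Suc w) - z w)\<^sup>2 / real (p+1) \<le> (\<Sum>e\<in>E. (x (?c w (snd e)) - x (?c w (fst e)))\<^sup>2)"
      using window_energy[OF fin ord deg cut mono const p, where a = "s + w*p"]
      by (simp add: z_def ac_simps)
  qed
  also have "\<dots> = (\<Sum>e\<in>E. \<Sum>w<m. (x (?c w (snd e)) - x (?c w (fst e)))\<^sup>2)"
    by (rule sum.swap)
  also have "\<dots> \<le> (\<Sum>e\<in>E. (x (max s (snd e)) - x (max s (fst e)))\<^sup>2)"
    using ord by (intro sum_mono windows_superadditive[OF mono]) (simp add: less_imp_le)
  finally have 2: "4 / real (p+1) * (\<Sum>w<m. (z (Suc w) - z w)\<^sup>2) \<le>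
      (\<Sum>e\<in>E. (x (max s (snd e)) - x (max s (fst e)))\<^sup>2)"
    by (simp add: sum_distrib_left)
  have "path_bound p m * (\<Sum>i=s..K. (x i - x s)\<^sup>2) =
      4 / (real p * real (p+1)) * (?l * (\<Sum>i=s..K. (x i - x s)\<^sup>2))"
    by (simp add: path_bound_def)
  also have "\<dots> \<le> 4 / (real p * real (p+1)) * (real p * (\<Sum>w<m. (z (Suc w) - z w)\<^sup>2))"
    by (intro mult_left_mono 1) simp
  also have "\<dots> = 4 / real (p+1) * (\<Sum>w<m. (z (Suc w) - z w)\<^sup>2)" using p by simp
  finally show ?thesis using 2 by linarith
qed

text \<open>
The part above \<open>s\<close> is \<open>upper_half_energy\<close>; the part below follows from it
by reversing the order and the sign of \<open>x\<close>. The two halves use the functions \<open>max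
(x s) x\<close> and \<open>min (x s) x\<close>, whose energies add up to at most the energy of
\<open>x\<close>.
\<close>

lemma two_sided_energy:
  fixes x :: "nat \<Rightarrow> real"
  assumes ord: "\<And>e. e \<in> E \<Longrightarrow> fst e < snd e \<and> snd e \<le> K"
    and deg: "\<And>v. v \<le> K \<Longrightarrow> card {e \<in> E. fst e = v \<or> snd e = v} \<le> 3"
    and cut: "\<And>k. k < K \<Longrightarrow> 2 \<le> card (crossing E k)"
    and mono: "\<And>i j. i \<le> j \<Longrightarrow> j \<le> K \<Longrightarrow> x i \<le> x j"
    and p: "1 \<le> p" and m: "1 \<le> m"
    and s: "s \<le> K" "s \<le> m * p" "K \<le> s + m * p"
  shows "path_bound p m * (\<Sum>i\<le>K. (x i - x s)\<^sup>2) \<le> (\<Sum>e\<in>E. (x (snd e) - x (fst e))\<^sup>2)"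
proof -
  have "E \<subseteq> {..K} \<times> {..K}" using ord by (force simp: mem_Times_iff)
  then have fin: "finite E" by (rule finite_subset) simp
  have deg': "card {e \<in> E. fst e = v \<or> snd e = v} \<le> 3" for v
  proof (cases "v \<le> K")
    case False
    then have "{e \<in> E. fst e = v \<or> snd e = v} = {}" using ord by force
    then show ?thesis by (metis card.empty le0)
  qed (rule deg)
  define y where "y i = x (min i K)" for i
  have yx: "y i = x i" if "i \<le> K" for i using that by (simp add: y_def)
  have up: "path_bound p m * (\<Sum>i=s..K. (y i - y s)\<^sup>2)
      \<le> (\<Sum>e\<in>E. (y (max s (snd e)) - y (max s (fst e)))\<^sup>2)"
    using ord s by (intro upper_half_energy[OF fin _ deg' cut _ _ p m])
      (auto simp: y_def intro!: monoI mono)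
  define r where "r e = (K - snd e, K - fst e)" for e :: "nat \<times> nat"
  define y' where "y' i = - x (K - i)" for i
  have inj: "inj_on r E"
  proof (rule inj_onI)
    fix e e' assume "e \<in> E" "e' \<in> E" "r e = r e'"
    with ord[of e] ord[of e'] show "e = e'"
      by (cases e; cases e') (auto simp: r_def)
  qed
  have down: "path_bound p m * (\<Sum>i=K-s..K. (y' i - y' (K-s))\<^sup>2)
      \<le> (\<Sum>e\<in>r`E. (y' (max (K-s) (snd e)) - y' (max (K-s) (fst e)))\<^sup>2)"
  proof (rule upper_half_energy[OF _ _ _ _ _ _ p m])
    show "card {e \<in> r ` E. fst e = v \<or> snd e = v} \<le> 3" for v
    proof (cases "v \<le> K")
      case True
      have "{e \<in> r ` E. fst e = v \<or> snd e = v} \<subseteq> r ` {e \<in> E. fst e = K - v \<or> snd e = K - v}"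
        using ord True by (fastforce simp: r_def)
      then have "card {e \<in> r ` E. fst e = v \<or> snd e = v} \<le> card (r ` {e \<in> E. fst e = K - v \<or> snd e = K - v})"
        using fin by (intro card_mono) auto
      also have "\<dots> \<le> card {e \<in> E. fst e = K - v \<or> snd e = K - v}"
        using fin by (intro card_image_le) auto
      also have "\<dots> \<le> 3" by (rule deg') 
      finally show ?thesis .
    next
      case False
      then have "{e \<in> r ` E. fst e = v \<or> snd e = v} = {}" by (auto simp: r_def)
      then show ?thesis by (metis card.empty le0)
    qed
    show "2 \<le> card (crossing (r ` E) k)" if "k < K" for k
    proof -
      have "crossing (r ` E) k = r ` crossing E (K - 1 - k)"
      proof -
        have "fst (r e) \<le> k \<and> k < snd (r e) \<longleftrightarrow> fst e \<le> K - 1 - k \<and> K - 1 - k < snd e"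
          if "e \<in> E" for e
          using ord[OF that] \<open>k < K\<close> unfolding r_def fst_conv snd_conv by linarith
        then show ?thesis unfolding crossing_def by blast
      qed
      moreover have "inj_on r (crossing E (K - 1 - k))"
        using inj crossing_subset inj_on_subset by blast
      ultimately show ?thesis using cut[of "K - 1 - k"] that by (simp add: card_image)
    qed
    show "fst e < snd e" if e: "e \<in> r ` E" for e
    proof -
      obtain d where "d \<in> E" "e = r d" using e by blast
      with ord[of d] show ?thesis unfolding r_def by simp linarith
    qed
    show "mono y'" unfolding y'_def by (intro monoI) (auto intro!: mono)
  qed (use fin ord s in \<open>auto simp: r_def y'_def\<close>)
  have "(\<Sum>i=K-s..K. (y' i - y' (K-s))\<^sup>2) = (\<Sum>i\<le>s. (x i - x s)\<^sup>2)"
    using s(1) by (intro sum.reindex_bij_witness[of _ "\<lambda>i. K - i" "\<lambda>i. K - i"])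
      (auto simp: y'_def power2_commute)
  moreover have "(\<Sum>e\<in>r`E. (y' (max (K-s) (snd e)) - y' (max (K-s) (fst e)))\<^sup>2) =
      (\<Sum>e\<in>E. (x (min s (snd e)) - x (min s (fst e)))\<^sup>2)"
  proof -
    have H: "y' (max (K-s) (K - i)) = - x (min s i)" if "i \<le> K" for i
    proof -
      have "K - max (K - s) (K - i) = min s i" using that s(1) by (auto simp: max_def min_def)
      then show ?thesis by (simp add: y'_def)
    qed
    show ?thesis unfolding sum.reindex[OF inj] comp_def
    proof (rule sum.cong[OF refl])
      fix e assume "e \<in> E"
      then have "fst e \<le> K" "snd e \<le> K" using ord[of e] by auto
      then show "(y' (max (K-s) (snd (r e))) - y' (max (K-s) (fst (r e))))\<^sup>2 =
          (x (min s (snd e)) - x (min s (fst e)))\<^sup>2" by (simp add: r_def H)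
    qed
  qed
  ultimately have down: "path_bound p m * (\<Sum>i\<le>s. (x i - x s)\<^sup>2) \<le>
      (\<Sum>e\<in>E. (x (min s (snd e)) - x (min s (fst e)))\<^sup>2)" using down by simp
  have "{..K} = {..s} \<union> {s..K}" using s(1) by auto
  then have "(\<Sum>i\<le>K. (x i - x s)\<^sup>2) = (\<Sum>i\<le>s. (x i - x s)\<^sup>2) + (\<Sum>i=s..K. (x i - x s)\<^sup>2) - (\<Sum>i\<in>{..s}\<inter>{s..K}. (x i - x s)\<^sup>2)"
    by (simp add: sum_Un)
  also have "{..s}\<inter>{s..K} = {s}" using s(1) by auto
  also have "(\<Sum>i=s..K. (x i - x s)\<^sup>2) = (\<Sum>i=s..K. (y i - y s)\<^sup>2)"
    using s(1) by (intro sum.cong) (auto simp: yx)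
  finally have "path_bound p m * (\<Sum>i\<le>K. (x i - x s)\<^sup>2) \<le>
      (\<Sum>e\<in>E. (y (max s (snd e)) - y (max s (fst e)))\<^sup>2) + (\<Sum>e\<in>E. (x (min s (snd e)) - x (min s (fst e)))\<^sup>2)"
    using up down by (simp add: distrib_left)
  also have "\<dots> = (\<Sum>e\<in>E. (y (max s (snd e)) - y (max s (fst e)))\<^sup>2 + (x (min s (snd e)) - x (min s (fst e)))\<^sup>2)"
    by (simp add: sum.distrib)
  also have "\<dots> \<le> (\<Sum>e\<in>E. (x (snd e) - x (fst e))\<^sup>2)"
  proof (rule sum_mono)
    fix e assume "e \<in> E"
    with ord have o: "fst e < snd e" "snd e \<le> K" by auto
    let ?a = "y (max s (snd e)) - y (max s (fst e))" and ?b = "x (min s (snd e)) - x (min s (fst e))"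
    have "0 \<le> ?a" "0 \<le> ?b" using o s(1) by (auto simp: y_def intro!: mono)
    then have "?a\<^sup>2 + ?b\<^sup>2 \<le> (?a + ?b)\<^sup>2" by (simp add: power2_sum)
    also have "?a + ?b = x (snd e) - x (fst e)"
      using o s(1) by (cases "snd e \<le> s"; cases "fst e \<le> s") (auto simp: y_def max_def min_def)
    finally show "?a\<^sup>2 + ?b\<^sup>2 \<le> (x (snd e) - x (fst e))\<^sup>2" .
  qed
  finally show ?thesis .
qed

section \<open>Variational bounds for the second smallest eigenvalue\<close>

text \<open>
The complexified matrix has an eigenvalue, and the Hermitian form makes it real.
\<close>

lemma real_symmetric_eigenvalue_exists:
  fixes A :: "real mat"
  assumes A: "A \<in> carrier_mat n n" and sym: "transpose_mat A = A" and n: "0 < n"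
  obtains e where "eigenvalue A e"
proof -
  let ?C = "map_mat complex_of_real A"
  have C: "?C \<in> carrier_mat n n" using A by simp
  from spectrum_non_empty[OF C n] obtain k where "eigenvalue ?C k"
    unfolding spectrum_def by auto
  then obtain v where v: "v \<in> carrier_vec n" "v \<noteq> 0\<^sub>v n" "?C *\<^sub>v v = k \<cdot>\<^sub>v v"
    using C unfolding eigenvalue_def eigenvector_def by auto
  have cv: "conjugate v \<in> carrier_vec n" using v by simp
  have conjC: "conjugate (?C *\<^sub>v v) = ?C *\<^sub>v conjugate v"
    using A v(1) by (intro eq_vecI) (auto simp: scalar_prod_def)
  have tC: "transpose_mat ?C = ?C" using sym A by (metis map_mat_transpose)
  have nz: "v \<bullet>c v \<noteq> 0" using v(1,2) by simp
  have "k * (v \<bullet>c v) = (?C *\<^sub>v v) \<bullet>c v" using v cv by simp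
  also have "\<dots> = (transpose_mat ?C *\<^sub>v v) \<bullet> conjugate v" by (simp only: tC)
  also have "\<dots> = v \<bullet> (?C *\<^sub>v conjugate v)" by (rule transpose_vec_mult_scalar[OF C cv v(1)])
  also have "\<dots> = v \<bullet> conjugate (k \<cdot>\<^sub>v v)" by (simp only: conjC[symmetric] v(3))
  also have "\<dots> = cnj k * (v \<bullet>c v)" using v cv by (simp add: conjugate_smult_vec)
  finally have "k = cnj k" using nz by simp
  then have k: "k = complex_of_real (Re k)" by (metis Reals_cnj_iff of_real_Re)
  have "poly (char_poly ?C) k = 0" using \<open>eigenvalue ?C k\<close> eigenvalue_root_char_poly[OF C] by blast
  then have "poly (map_poly complex_of_real (char_poly A)) (complex_of_real (Re k)) = 0"
    using of_real_hom.char_poly_hom[OF A] k by metis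
  then have "poly (char_poly A) (Re k) = 0"
    by (simp only: of_real_hom.poly_map_poly of_real_eq_0_iff)
  then show ?thesis using that eigenvalue_root_char_poly[OF A] by blast
qed

text \<open>
Gram--Schmidt applied to a basis starting with \<open>v\<close>, followed by normalization.
\<close>

lemma orthogonal_completion:
  fixes v :: "real vec"
  assumes v: "v \<in> carrier_vec n" and v0: "v \<noteq> 0\<^sub>v n"
  obtains W c where "W \<in> carrier_mat n n" "transpose_mat W * W = 1\<^sub>m n" "col W 0 = c \<cdot>\<^sub>v v"
proof -
  interpret cof_vec_space n "TYPE(real)" .
  define b where "b = basis_completion v"
  define ws where "ws = gram_schmidt n b"
  have n: "0 < n" using v v0 by (cases n) auto
  from basis_completion[OF v v0, folded b_def]
  have dist_b: "distinct b" and indep: "\<not> lin_dep (set b)" and b: "set b \<subseteq> carrier_vec n"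
    and hdb: "hd b = v" and len_b: "length b = n" by auto
  from hdb len_b n obtain vs where bv: "b = v # vs" by (cases b, auto)
  from gram_schmidt_result[OF b dist_b indep refl, folded ws_def]
  have ws: "set ws \<subseteq> carrier_vec n" "corthogonal ws" "length ws = n" by (auto simp: len_b)
  from gram_schmidt_hd[OF v, of vs, folded bv] have hdws: "hd ws = v" unfolding ws_def .
  have wsi: "ws ! i \<in> carrier_vec n" if "i < n" for i using ws that by auto
  define l where "l i = sqrt (ws ! i \<bullet> ws ! i)" for i
  have pos: "0 < ws ! i \<bullet> ws ! i" if "i < n" for i
  proof -
    have "ws ! i \<bullet> ws ! i \<noteq> 0" using corthogonalD[OF ws(2), of i i] that ws(3) by simp
    moreover have "0 \<le> ws ! i \<bullet> ws ! i" by (simp add: scalar_prod_def sum_nonneg)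
    ultimately show ?thesis by simp
  qed
  define W where "W = mat n n (\<lambda>(i, j). (ws ! j) $ i / l j)"
  have W: "W \<in> carrier_mat n n" by (simp add: W_def)
  have colW: "col W j = (1 / l j) \<cdot>\<^sub>v ws ! j" if "j < n" for j
    using that wsi[OF that] by (intro eq_vecI) (auto simp: W_def)
  have "transpose_mat W * W = 1\<^sub>m n"
  proof (rule eq_matI)
    fix i j assume "i < dim_row (1\<^sub>m n :: real mat)" "j < dim_col (1\<^sub>m n :: real mat)"
    then have ij: "i < n" "j < n" by auto
    have "(transpose_mat W * W) $$ (i, j) = col W i \<bullet> col W j" using ij W by simp
    also have "\<dots> = (ws ! i \<bullet> ws ! j) / (l i * l j)"
      using ij wsi[OF ij(1)] wsi[OF ij(2)]
      by (simp add: colW smult_scalar_prod_distrib[of _ n] scalar_prod_smult_distrib[of _ n])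
    also have "\<dots> = (1\<^sub>m n) $$ (i, j)"
    proof (cases "i = j")
      case True
      then show ?thesis using pos[OF ij(1)] ij by (simp add: l_def)
    next
      case False
      then have "ws ! i \<bullet> ws ! j = 0" using corthogonalD[OF ws(2), of i j] ij ws(3) by simp
      then show ?thesis using False ij by simp
    qed
    finally show "(transpose_mat W * W) $$ (i, j) = (1\<^sub>m n) $$ (i, j)" .
  qed (use W in auto)
  moreover have "col W 0 = (1 / l 0) \<cdot>\<^sub>v v"
    using colW[OF n] hdws ws(3) n by (metis hd_conv_nth length_greater_0_conv)
  ultimately show ?thesis using that W by blast
qed

text \<open>
The spectral theorem, by induction on the dimension. In an orthonormal basis starting with an
eigenvector the first column of \<open>A\<close> is a multiple of the first unit vector, by symmetry
so is the first row, and the remaining block is again symmetric.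
\<close>

lemma orthogonal_diagonalization:
  fixes A :: "real mat"
  assumes "A \<in> carrier_mat n n" "transpose_mat A = A"
  shows "\<exists>P D. P \<in> carrier_mat n n \<and> D \<in> carrier_mat n n \<and> diagonal_mat D \<and>
      transpose_mat P * P = 1\<^sub>m n \<and> transpose_mat P * A * P = D"
  using assms
proof (induction n arbitrary: A)
  case 0
  then show ?case by (intro exI[of _ "1\<^sub>m 0"] exI[of _ A]) (auto simp: diagonal_mat_def)
next
  case (Suc n A)
  note A = Suc.prems(1) and sym = Suc.prems(2)
  obtain e where "eigenvalue A e" using real_symmetric_eigenvalue_exists[OF A sym] by auto
  then obtain v where v: "v \<in> carrier_vec (Suc n)" "v \<noteq> 0\<^sub>v (Suc n)" "A *\<^sub>v v = e \<cdot>\<^sub>v v"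
    using A unfolding eigenvalue_def eigenvector_def by auto
  obtain W c where W: "W \<in> carrier_mat (Suc n) (Suc n)" "transpose_mat W * W = 1\<^sub>m (Suc n)"
      "col W 0 = c \<cdot>\<^sub>v v"
    using orthogonal_completion[OF v(1,2)] by blast
  define A' where "A' = transpose_mat W * A * W"
  have tW: "transpose_mat W \<in> carrier_mat (Suc n) (Suc n)" using W by simp
  have A': "A' \<in> carrier_mat (Suc n) (Suc n)" using A W by (simp add: A'_def)
  have A'sym: "transpose_mat A' = A'"
    using A W tW by (simp add: A'_def transpose_mult[of _ "Suc n" "Suc n" _ "Suc n"] sym assoc_mult_mat[of _ "Suc n" "Suc n" _ "Suc n" _ "Suc n"])
  have symA': "A' $$ (i, j) = A' $$ (j, i)" if "i < Suc n" "j < Suc n" for i j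
    using that A' arg_cong[OF A'sym, of "\<lambda>M. M $$ (i, j)"] by simp
  have col0: "A' $$ (i, 0) = (if i = 0 then e else 0)" if i: "i < Suc n" for i
  proof -
    have "A' $$ (i, 0) = row (transpose_mat W) i \<bullet> col (A * W) 0"
      using i A W by (simp add: A'_def assoc_mult_mat[of _ "Suc n" "Suc n" _ "Suc n" _ "Suc n"])
    also have "row (transpose_mat W) i = col W i" using i W by simp
    also have "col (A * W) 0 = A *\<^sub>v col W 0" by (rule col_mult2[OF A W(1)]) simp
    also have "\<dots> = e \<cdot>\<^sub>v col W 0"
      by (simp only: W(3) mult_mat_vec[OF A v(1)] v(3) smult_smult_assoc mult.commute)
    also have "col W i \<bullet> \<dots> = e * (col W i \<bullet> col W 0)" 
      using W(1) by (intro scalar_prod_smult_distrib[of _ "Suc n"] carrier_vecI) auto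
    also have "col W i \<bullet> col W 0 = (transpose_mat W * W) $$ (i, 0)" using W(1) i by simp
    also have "\<dots> = (if i = 0 then 1 else 0)" using W(2) i by simp
    finally show ?thesis by simp
  qed
  define A3 where "A3 = mat n n (\<lambda>(i, j). A' $$ (Suc i, Suc j))"
  have A3: "A3 \<in> carrier_mat n n" by (simp add: A3_def)
  have "transpose_mat A3 = A3" using symA' by (intro eq_matI) (auto simp: A3_def)
  from Suc.IH[OF A3 this] obtain P3 D3 where P3: "P3 \<in> carrier_mat n n"
    and D3: "D3 \<in> carrier_mat n n" "diagonal_mat D3"
    and P3o: "transpose_mat P3 * P3 = 1\<^sub>m n" and P3d: "transpose_mat P3 * A3 * P3 = D3" by blast
  define E where "E = mat 1 1 (\<lambda>_. e)"
  have E: "E \<in> carrier_mat 1 1" by (simp add: E_def)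
  have block: "A' = four_block_mat E (0\<^sub>m 1 n) (0\<^sub>m n 1) A3"
    using A' col0 symA'[of 0] by (intro eq_matI) (auto simp: E_def A3_def)
  define F where "F = four_block_mat (1\<^sub>m 1) (0\<^sub>m 1 n) (0\<^sub>m n 1) P3"
  define D where "D = four_block_mat E (0\<^sub>m 1 n) (0\<^sub>m n 1) D3"
  have F: "F \<in> carrier_mat (Suc n) (Suc n)" using P3 by (auto simp: F_def)
  have tF: "transpose_mat F = four_block_mat (1\<^sub>m 1) (0\<^sub>m 1 n) (0\<^sub>m n 1) (transpose_mat P3)"
    unfolding F_def using P3 by (subst transpose_four_block_mat[of _ 1 1 _ n _ n]) auto
  have tFc: "transpose_mat F \<in> carrier_mat (Suc n) (Suc n)" using F by simp
  have tP3: "transpose_mat P3 \<in> carrier_mat n n" using P3 by simp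
  have Fo: "transpose_mat F * F = 1\<^sub>m (Suc n)"
    unfolding tF unfolding F_def using P3 tP3 P3o
    by (subst mult_four_block_mat[of _ 1 1 _ n _ n _ _ 1 _ n]) auto
  have FA: "transpose_mat F * A' = four_block_mat E (0\<^sub>m 1 n) (0\<^sub>m n 1) (transpose_mat P3 * A3)"
    unfolding tF block using P3 tP3 A3 E
    by (subst mult_four_block_mat[of _ 1 1 _ n _ n _ _ 1 _ n]) auto
  have FAF: "transpose_mat F * A' * F = D"
    unfolding FA unfolding F_def D_def using P3 tP3 A3 E P3d
    by (subst mult_four_block_mat[of _ 1 1 _ n _ n _ _ 1 _ n]) auto
  have Dc: "D \<in> carrier_mat (Suc n) (Suc n)" using D3 E by (auto simp: D_def)
  have Dd: "diagonal_mat D"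
    using D3 E by (auto simp: D_def diagonal_mat_def)
  let ?P = "W * F"
  note assoc = assoc_mult_mat[of _ "Suc n" "Suc n" _ "Suc n" _ "Suc n"]
  have tP: "transpose_mat ?P = transpose_mat F * transpose_mat W"
    by (rule transpose_mult[OF W(1) F])
  have "transpose_mat ?P * ?P = transpose_mat F * (transpose_mat W * W) * F"
    unfolding tP using W(1) tW F tFc by (simp add: assoc)
  also have "\<dots> = 1\<^sub>m (Suc n)" unfolding W(2) using tFc F Fo by simp
  finally have o: "transpose_mat ?P * ?P = 1\<^sub>m (Suc n)" .
  have "transpose_mat ?P * A * ?P = transpose_mat F * A' * F"
    unfolding tP A'_def using W tW F tFc A by (simp add: assoc)
  then have d: "transpose_mat ?P * A * ?P = D" using FAF by simp
  have "?P \<in> carrier_mat (Suc n) (Suc n)" using W F by simp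
  then show ?case using Dc Dd o d by blast
qed

lemma sorted_eigenvalues_orthogonal_diagonalization:
  fixes A :: "real mat"
  assumes A: "A \<in> carrier_mat n n" and P: "P \<in> carrier_mat n n" and D: "D \<in> carrier_mat n n"
    and dg: "diagonal_mat D" and o: "transpose_mat P * P = 1\<^sub>m n"
    and d: "transpose_mat P * A * P = D"
  shows "P * transpose_mat P = 1\<^sub>m n" "sorted_eigenvalues A = sort (diag_mat D)"
proof -
  have tP: "transpose_mat P \<in> carrier_mat n n" using P by simp
  show PP: "P * transpose_mat P = 1\<^sub>m n" by (rule mat_mult_left_right_inverse[OF tP P o])
  have "similar_mat_wit D A (transpose_mat P) P"
    by (rule similar_mat_witI[OF o PP d[symmetric] D A tP P])
  then have "char_poly A = char_poly D"
    using char_poly_similar similar_mat_def by metis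
  also have "\<dots> = (\<Prod>a\<leftarrow>diag_mat D. [:- a, 1:])"
    using dg D by (intro char_poly_upper_triangular[of _ n]) (auto simp: diagonal_mat_def)
  also have "proots \<dots> = mset (diag_mat D)"
  proof -
    have "proots (\<Prod>a\<leftarrow>es. [:- a, 1:]) = mset es \<and> (\<Prod>a\<leftarrow>es. [:- a, 1:]) \<noteq> 0" for es :: "real list"
      by (induction es) (auto simp: proots_mult simp del: mult_pCons_left)
    then show ?thesis by blast
  qed
  finally show "sorted_eigenvalues A = sort (diag_mat D)"
    by (simp add: sorted_eigenvalues_def)
qed

text \<open>
Coordinates \<open>c x i\<close> with respect to an orthonormal eigenbasis that is listed in the
order of the sorted eigenvalues.
\<close>

lemma eigenbasis_coordinates:
  fixes A :: "real mat"
  assumes A: "A \<in> carrier_mat n n" and sym: "transpose_mat A = A"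
  obtains c :: "real vec \<Rightarrow> nat \<Rightarrow> real" where
    "\<And>x y a b i. x \<in> carrier_vec n \<Longrightarrow> y \<in> carrier_vec n \<Longrightarrow> i < n \<Longrightarrow>
       c (a \<cdot>\<^sub>v x + b \<cdot>\<^sub>v y) i = a * c x i + b * c y i"
    "\<And>x. x \<in> carrier_vec n \<Longrightarrow> x \<bullet> x = (\<Sum>i<n. (c x i)\<^sup>2)"
    "\<And>x. x \<in> carrier_vec n \<Longrightarrow> x \<bullet> (A *\<^sub>v x) = (\<Sum>i<n. sorted_eigenvalues A ! i * (c x i)\<^sup>2)"
    "\<And>y. \<exists>x \<in> carrier_vec n. \<forall>i<n. c x i = y i"
    "length (sorted_eigenvalues A) = n" "sorted (sorted_eigenvalues A)"
proof -
  obtain P D where P: "P \<in> carrier_mat n n" and D: "D \<in> carrier_mat n n" "diagonal_mat D"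
    and o: "transpose_mat P * P = 1\<^sub>m n" and d: "transpose_mat P * A * P = D"
    using orthogonal_diagonalization[OF A sym] by blast
  note PP = sorted_eigenvalues_orthogonal_diagonalization(1)[OF A P D o d]
    and es = sorted_eigenvalues_orthogonal_diagonalization(2)[OF A P D o d]
  have tP: "transpose_mat P \<in> carrier_mat n n" using P by simp
  have lenD: "length (diag_mat D) = n" using D by (simp add: diag_mat_def)
  \<comment> \<open>The diagonal lists the eigenvalues in some order; \<open>p\<close> rearranges the eigenbasis accordingly.\<close>
  have "mset (sort (diag_mat D)) = mset (diag_mat D)" by simp
  then obtain p where p: "p permutes {..<n}" and ps: "permute_list p (diag_mat D) = sort (diag_mat D)"
    using mset_eq_permutation lenD by metis
  have pn: "p i < n" if "i < n" for i using permutes_in_image[OF p, of i] that by simp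
  have esi: "sorted_eigenvalues A ! i = D $$ (p i, p i)" if "i < n" for i
  proof -
    have "sorted_eigenvalues A ! i = diag_mat D ! p i"
      unfolding es ps[symmetric] using that lenD p by (subst permute_list_nth) auto
    then show ?thesis using pn[OF that] D by (simp add: diag_mat_def)
  qed
  define c where "c x i = (transpose_mat P *\<^sub>v x) $ p i" for x i
  have reindex: "(\<Sum>i<n. f (p i)) = (\<Sum>i<n. f i)" for f :: "nat \<Rightarrow> real"
    using sum.permute[OF p, of f] by (simp add: o_def)
  have expand: "P *\<^sub>v (transpose_mat P *\<^sub>v x) = x" if "x \<in> carrier_vec n" for x
    using that P tP PP by (simp flip: assoc_mult_mat_vec)
  show ?thesis
  proof (rule that[of c])
    fix x y :: "real vec" and a b :: real and i
    assume "x \<in> carrier_vec n" "y \<in> carrier_vec n" "i < n"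
    then show "c (a \<cdot>\<^sub>v x + b \<cdot>\<^sub>v y) i = a * c x i + b * c y i"
      using tP pn[of i] unfolding c_def by (simp add: mult_add_distrib_mat_vec[OF tP] mult_mat_vec[OF tP])
  next
    fix x :: "real vec" assume x: "x \<in> carrier_vec n"
    define z where "z = transpose_mat P *\<^sub>v x"
    have z: "z \<in> carrier_vec n" using tP x by (simp add: z_def)
    have xz: "x = P *\<^sub>v z" using expand[OF x] by (simp add: z_def)
    have "x \<bullet> x = x \<bullet> (P *\<^sub>v z)" by (simp only: xz[symmetric])
    also have "\<dots> = z \<bullet> z" using transpose_vec_mult_scalar[OF P z x] by (simp add: z_def)
    also have "\<dots> = (\<Sum>i<n. (z $ i)\<^sup>2)"
      using z by (simp add: scalar_prod_def power2_eq_square lessThan_atLeast0)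
    also have "\<dots> = (\<Sum>i<n. (c x i)\<^sup>2)"
      using reindex[of "\<lambda>i. (z $ i)\<^sup>2"] by (simp add: c_def z_def)
    finally show "x \<bullet> x = (\<Sum>i<n. (c x i)\<^sup>2)" .
    have "x \<bullet> (A *\<^sub>v x) = (A *\<^sub>v x) \<bullet> (P *\<^sub>v z)"
      using xz x A by (metis comm_scalar_prod mult_mat_vec_carrier)
    also have "\<dots> = (transpose_mat P *\<^sub>v (A *\<^sub>v x)) \<bullet> z"
      using transpose_vec_mult_scalar[OF P z] A x by simp
    also have "transpose_mat P *\<^sub>v (A *\<^sub>v x) = D *\<^sub>v z"
      unfolding d[symmetric] using xz A P tP z
      by (simp add: assoc_mult_mat_vec[of _ n n _ n])
    also have "D *\<^sub>v z = vec n (\<lambda>i. D $$ (i, i) * z $ i)"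
    proof (rule eq_vecI)
      fix i assume "i < dim_vec (vec n (\<lambda>i. D $$ (i, i) * z $ i))"
      then have i: "i < n" by simp
      have "(D *\<^sub>v z) $ i = (\<Sum>j<n. D $$ (i, j) * z $ j)"
        using D z i by (simp add: scalar_prod_def lessThan_atLeast0)
      also have "\<dots> = (\<Sum>j<n. if j = i then D $$ (i, i) * z $ i else 0)"
        using D i by (intro sum.cong) (auto simp: diagonal_mat_def)
      also have "\<dots> = D $$ (i, i) * z $ i" using i by simp
      finally show "(D *\<^sub>v z) $ i = vec n (\<lambda>i. D $$ (i, i) * z $ i) $ i" using i by simp
    qed (use D in simp)
    also have "\<dots> \<bullet> z = (\<Sum>i<n. D $$ (i, i) * (z $ i)\<^sup>2)"
      using z by (simp add: scalar_prod_def power2_eq_square lessThan_atLeast0 mult.assoc)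
    also have "\<dots> = (\<Sum>i<n. sorted_eigenvalues A ! i * (c x i)\<^sup>2)"
      using reindex[of "\<lambda>i. D $$ (i, i) * (z $ i)\<^sup>2"] by (simp add: c_def z_def esi)
    finally show "x \<bullet> (A *\<^sub>v x) = (\<Sum>i<n. sorted_eigenvalues A ! i * (c x i)\<^sup>2)" .
  next
    fix y :: "nat \<Rightarrow> real"
    define w where "w = vec n (\<lambda>i. y (inv_into UNIV p i))"
    have w: "w \<in> carrier_vec n" by (simp add: w_def)
    have "transpose_mat P *\<^sub>v (P *\<^sub>v w) = w"
      using P tP w o by (simp flip: assoc_mult_mat_vec)
    then have "\<forall>i<n. c (P *\<^sub>v w) i = y i"
      using pn permutes_inverses(2)[OF p] by (simp add: c_def w_def)
    moreover have "P *\<^sub>v w \<in> carrier_vec n" using P w by simp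
    ultimately show "\<exists>x \<in> carrier_vec n. \<forall>i<n. c x i = y i" by blast
  qed (simp_all add: es lenD)
qed

text \<open>
A two-dimensional space contains a nonzero vector orthogonal to the first eigenvector, and the
Rayleigh quotient of such a vector is at least the second eigenvalue.
\<close>

lemma second_eigenvalue_le:
  fixes A :: "real mat"
  assumes A: "A \<in> carrier_mat n n" and sym: "transpose_mat A = A" and n: "2 \<le> n"
    and u: "u \<in> carrier_vec n" and v: "v \<in> carrier_vec n"
    and ind: "\<And>a b. a \<noteq> 0 \<or> b \<noteq> 0 \<Longrightarrow> a \<cdot>\<^sub>v u + b \<cdot>\<^sub>v v \<noteq> 0\<^sub>v n"
    and le: "\<And>a b. (a \<cdot>\<^sub>v u + b \<cdot>\<^sub>v v) \<bullet> (A *\<^sub>v (a \<cdot>\<^sub>v u + b \<cdot>\<^sub>v v))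
        \<le> \<mu> * ((a \<cdot>\<^sub>v u + b \<cdot>\<^sub>v v) \<bullet> (a \<cdot>\<^sub>v u + b \<cdot>\<^sub>v v))"
  shows "sorted_eigenvalues A ! 1 \<le> \<mu>"
proof (rule eigenbasis_coordinates[OF A sym])
  let ?e = "\<lambda>i. sorted_eigenvalues A ! i"
  fix c :: "real vec \<Rightarrow> nat \<Rightarrow> real"
  assume lin: "\<And>x y a b i. x \<in> carrier_vec n \<Longrightarrow> y \<in> carrier_vec n \<Longrightarrow> i < n \<Longrightarrow>
       c (a \<cdot>\<^sub>v x + b \<cdot>\<^sub>v y) i = a * c x i + b * c y i"
    and norm: "\<And>x. x \<in> carrier_vec n \<Longrightarrow> x \<bullet> x = (\<Sum>i<n. (c x i)\<^sup>2)"
    and quad: "\<And>x. x \<in> carrier_vec n \<Longrightarrow> x \<bullet> (A *\<^sub>v x) = (\<Sum>i<n. ?e i * (c x i)\<^sup>2)"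
    and surj: "\<And>y. \<exists>x \<in> carrier_vec n. \<forall>i<n. c x i = y i"
    and len: "length (sorted_eigenvalues A) = n" and srt: "sorted (sorted_eigenvalues A)"
  obtain a b :: real where ab: "a \<noteq> 0 \<or> b \<noteq> 0" "a * c u 0 + b * c v 0 = 0"
  proof (cases "c v 0 = 0")
    case True
    then show ?thesis using that[of 0 1] by simp
  next
    case False
    then show ?thesis using that[of "c v 0" "- c u 0"] by simp
  qed
  define w where "w = a \<cdot>\<^sub>v u + b \<cdot>\<^sub>v v"
  have w: "w \<in> carrier_vec n" using u v by (simp add: w_def)
  have c0: "c w 0 = 0" using lin[OF u v, of 0 a b] ab n by (simp add: w_def)
  have "?e 1 * (w \<bullet> w) = (\<Sum>i<n. ?e 1 * (c w i)\<^sup>2)" by (simp add: norm[OF w] sum_distrib_left)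
  also have "\<dots> \<le> (\<Sum>i<n. ?e i * (c w i)\<^sup>2)"
  proof (rule sum_mono)
    fix i assume i: "i \<in> {..<n}"
    show "?e 1 * (c w i)\<^sup>2 \<le> ?e i * (c w i)\<^sup>2"
    proof (cases "i = 0")
      case False
      then have "?e 1 \<le> ?e i" using i len srt by (intro sorted_nth_mono) auto
      then show ?thesis by (intro mult_right_mono) auto
    qed (use c0 in simp)
  qed
  also have "\<dots> \<le> \<mu> * (w \<bullet> w)" using le[of a b] quad[OF w] by (simp add: w_def)
  finally have "?e 1 * (w \<bullet> w) \<le> \<mu> * (w \<bullet> w)" .
  moreover have "0 < w \<bullet> w"
  proof -
    have "w \<noteq> 0\<^sub>v n" using ind[OF ab(1)] by (simp add: w_def)
    then have "w \<bullet>c w \<noteq> 0" using w conjugate_square_eq_0_vec by blast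
    moreover have "0 \<le> w \<bullet> w" by (simp add: scalar_prod_def sum_nonneg)
    ultimately show ?thesis by simp
  qed
  ultimately show ?thesis by simp
qed

text \<open>
Conversely, the span of the first two eigenvectors contains a nonzero vector orthogonal to
\<open>u\<close>, and its Rayleigh quotient is at most the second eigenvalue.
\<close>

lemma le_second_eigenvalue:
  fixes A :: "real mat"
  assumes A: "A \<in> carrier_mat n n" and sym: "transpose_mat A = A" and n: "2 \<le> n"
    and u: "u \<in> carrier_vec n"
    and ge: "\<And>x. x \<in> carrier_vec n \<Longrightarrow> x \<bullet> u = 0 \<Longrightarrow> \<mu> * (x \<bullet> x) \<le> x \<bullet> (A *\<^sub>v x)"
  shows "\<mu> \<le> sorted_eigenvalues A ! 1"
proof (rule eigenbasis_coordinates[OF A sym])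
  let ?e = "\<lambda>i. sorted_eigenvalues A ! i"
  fix c :: "real vec \<Rightarrow> nat \<Rightarrow> real"
  assume lin: "\<And>x y a b i. x \<in> carrier_vec n \<Longrightarrow> y \<in> carrier_vec n \<Longrightarrow> i < n \<Longrightarrow>
       c (a \<cdot>\<^sub>v x + b \<cdot>\<^sub>v y) i = a * c x i + b * c y i"
    and norm: "\<And>x. x \<in> carrier_vec n \<Longrightarrow> x \<bullet> x = (\<Sum>i<n. (c x i)\<^sup>2)"
    and quad: "\<And>x. x \<in> carrier_vec n \<Longrightarrow> x \<bullet> (A *\<^sub>v x) = (\<Sum>i<n. ?e i * (c x i)\<^sup>2)"
    and surj: "\<And>y. \<exists>x \<in> carrier_vec n. \<forall>i<n. c x i = y i"
    and len: "length (sorted_eigenvalues A) = n" and srt: "sorted (sorted_eigenvalues A)"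
  obtain x0 where x0: "x0 \<in> carrier_vec n" "\<forall>i<n. c x0 i = (if i = 0 then 1 else 0)"
    using surj[of "\<lambda>i. if i = 0 then 1 else 0"] by blast
  obtain x1 where x1: "x1 \<in> carrier_vec n" "\<forall>i<n. c x1 i = (if i = 1 then 1 else 0)"
    using surj[of "\<lambda>i. if i = 1 then 1 else 0"] by blast
  obtain a b :: real where ab: "a \<noteq> 0 \<or> b \<noteq> 0" "a * (x0 \<bullet> u) + b * (x1 \<bullet> u) = 0"
  proof (cases "x1 \<bullet> u = 0")
    case True
    then show ?thesis using that[of 0 1] by simp
  next
    case False
    then show ?thesis using that[of "x1 \<bullet> u" "- (x0 \<bullet> u)"] by simp
  qed
  define w where "w = a \<cdot>\<^sub>v x0 + b \<cdot>\<^sub>v x1"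
  have w: "w \<in> carrier_vec n" using x0 x1 by (simp add: w_def)
  have cw: "c w i = (if i = 0 then a else if i = 1 then b else 0)" if "i < n" for i
    using lin[OF x0(1) x1(1) that, of a b] x0(2) x1(2) that by (auto simp: w_def)
  have two: "(\<Sum>i<n. f i) = f 0 + f 1" if "\<And>i. 2 \<le> i \<Longrightarrow> i < n \<Longrightarrow> f i = 0" for f :: "nat \<Rightarrow> real"
  proof -
    have "(\<Sum>i<n. f i) = (\<Sum>i\<in>{0, 1}. f i)"
      using n that by (intro sum.mono_neutral_right) auto
    then show ?thesis by simp
  qed
  have n2: "w \<bullet> w = a\<^sup>2 + b\<^sup>2"
    unfolding norm[OF w] by (subst two) (use n cw in auto)
  have q2: "w \<bullet> (A *\<^sub>v w) = ?e 0 * a\<^sup>2 + ?e 1 * b\<^sup>2"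
    unfolding quad[OF w] by (subst two) (use n cw in auto)
  have "w \<bullet> u = 0"
    using ab(2) x0 x1 u by (simp add: w_def add_scalar_prod_distrib[of _ n])
  then have "\<mu> * (a\<^sup>2 + b\<^sup>2) \<le> ?e 0 * a\<^sup>2 + ?e 1 * b\<^sup>2"
    using ge[OF w] n2 q2 by simp
  also have "\<dots> \<le> ?e 1 * (a\<^sup>2 + b\<^sup>2)"
  proof -
    have "?e 0 \<le> ?e 1" using n len srt by (intro sorted_nth_mono) auto
    then show ?thesis by (simp add: distrib_left mult_right_mono)
  qed
  finally have "\<mu> * (a\<^sup>2 + b\<^sup>2) \<le> ?e 1 * (a\<^sup>2 + b\<^sup>2)" .
  moreover have "0 < a\<^sup>2 + b\<^sup>2" using ab(1) by (simp add: sum_power2_gt_zero_iff)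
  ultimately show ?thesis by simp
qed

section \<open>The Laplacian and the cuts of a cubic bipartite graph\<close>

lemma vertex_degree_eq_card_neighbours:
  "vertex_degree G v = card {w. (v, w) \<in> parcs G}"
proof -
  have "out_arcs (with_proj G) v = Pair v ` {w. (v, w) \<in> parcs G}"
    by (auto simp: out_arcs_def)
  then show ?thesis
    by (simp add: vertex_degree_def out_degree_def card_image inj_on_def)
qed

lemma card_arcs_between_sym:
  assumes "pair_graph G"
  shows "card {(u, v) \<in> parcs G. u \<in> X \<and> v \<in> Y} = card {(u, v) \<in> parcs G. u \<in> Y \<and> v \<in> X}"
proof -
  interpret pair_graph G by fact
  have "{(u, v) \<in> parcs G. u \<in> Y \<and> v \<in> X} = prod.swap ` {(u, v) \<in> parcs G. u \<in> X \<and> v \<in> Y}"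
    by (auto simp: image_iff intro: arcs_symmetric)
  then show ?thesis by (simp add: card_image)
qed

lemma cubic_card_arcs_from:
  assumes "pair_graph G" "cubic G" "X \<subseteq> pverts G"
  shows "card {(u, v) \<in> parcs G. u \<in> X} = 3 * card X"
proof -
  interpret pair_graph G by fact
  have fin: "finite {w. (u, w) \<in> parcs G}" for u
  proof (rule finite_subset)
    show "{w. (u, w) \<in> parcs G} \<subseteq> pverts G" by (auto dest: in_arcsD2)
  qed simp
  have finX: "finite X" using assms(3) pair_finite_verts finite_subset by blast
  have "{(u, v) \<in> parcs G. u \<in> X} = (SIGMA u:X. {w. (u, w) \<in> parcs G})" by auto
  then have "card {(u, v) \<in> parcs G. u \<in> X} = (\<Sum>u\<in>X. card {w. (u, w) \<in> parcs G})"
    using fin finX by simp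
  also have "\<dots> = (\<Sum>u\<in>X. 3)"
    using assms(2,3) by (intro sum.cong) (auto simp: cubic_def vertex_degree_eq_card_neighbours)
  finally show ?thesis by simp
qed

lemma connected_cut_nonempty:
  assumes "pair_graph G" and conn: "Digraph_Component.connected (with_proj G)"
    and X: "X \<subseteq> pverts G" "X \<noteq> {}" "X \<noteq> pverts G"
  shows "{(u, v) \<in> parcs G. u \<in> X \<and> v \<notin> X} \<noteq> {}"
proof
  assume none: "{(u, v) \<in> parcs G. u \<in> X \<and> v \<notin> X} = {}"
  interpret pair_graph G by fact
  obtain u w where u: "u \<in> X" and w: "w \<in> pverts G" "w \<notin> X" using X by blast
  have "u \<rightarrow>\<^sup>*\<^bsub>with_proj (mk_symmetric (with_proj G))\<^esub> w"
    using conn u w X(1) unfolding Digraph_Component.connected_def strongly_connected_def by auto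
  then have "u \<rightarrow>\<^sup>*\<^bsub>with_proj G\<^esub> w"
    using reachable_mk_symmetric_eq[OF pair_sym_arcs] by blast
  then have "(u, w) \<in> (parcs G)\<^sup>*"
    unfolding reachable_def by (auto dest: rtrancl_on_rtranclI)
  then have "w \<in> X" using u none by (induction rule: rtrancl_induct) auto
  then show False using w by simp
qed

text \<open>
Let \<open>U\<close> and \<open>W\<close> be the colour classes. The edges inside \<open>X\<close>
are counted once from \<open>X \<inter> U\<close> and once from \<open>X \<inter> W\<close>; as all
degrees are 3, the numbers of cut edges at \<open>X \<inter> U\<close> and at \<open>X \<inter>
W\<close> are congruent modulo 3. For a single cut edge they would be 0 and 1.
\<close>

lemma cubic_bipartite_cut:
  assumes G: "pair_graph G" and conn: "Digraph_Component.connected (with_proj G)"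
    and cub: "cubic G" and bip: "bipartite G"
    and X: "X \<subseteq> pverts G" "X \<noteq> {}" "X \<noteq> pverts G"
  shows "2 \<le> card {(u, v) \<in> parcs G. u \<in> X \<and> v \<notin> X}"
proof -
  interpret pair_graph G by fact
  obtain U W where UW: "pverts G = U \<union> W" "U \<inter> W = {}"
    and arcs0: "\<forall>(u, v) \<in> parcs G. (u \<in> U \<and> v \<in> W) \<or> (u \<in> W \<and> v \<in> U)"
    using bip unfolding bipartite_def by (elim exE conjE)
  have arcs: "(u \<in> U \<and> v \<in> W) \<or> (u \<in> W \<and> v \<in> U)" if "(u, v) \<in> parcs G" for u v
    using bspec[OF arcs0 that] by simp
  let ?ar = "\<lambda>Y Z. {(u, v) \<in> parcs G. u \<in> Y \<and> v \<in> Z}"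
  let ?XU = "X \<inter> U" and ?XW = "X \<inter> W"
  have UtoW: "v \<in> W" if "(u, v) \<in> parcs G" "u \<in> U" for u v
    using arcs[OF that(1)] that(2) UW(2) by auto
  have WtoU: "v \<in> U" if "(u, v) \<in> parcs G" "u \<in> W" for u v
    using arcs[OF that(1)] that(2) UW(2) by auto
  have fin: "finite (?ar Y Z)" for Y Z by (rule finite_subset[OF _ pair_finite_arcs]) auto
  have "3 * card ?XU = card {(u, v) \<in> parcs G. u \<in> ?XU}"
    using X(1) by (intro cubic_card_arcs_from[OF G cub, symmetric]) auto
  also have "{(u, v) \<in> parcs G. u \<in> ?XU} = ?ar ?XU ?XW \<union> ?ar ?XU (-X)"
    using UtoW by auto
  also have "card \<dots> = card (?ar ?XU ?XW) + card (?ar ?XU (-X))"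
    by (rule card_Un_disjoint[OF fin fin]) auto
  finally have cU: "3 * card ?XU = card (?ar ?XU ?XW) + card (?ar ?XU (-X))" .
  have "3 * card ?XW = card {(u, v) \<in> parcs G. u \<in> ?XW}"
    using X(1) by (intro cubic_card_arcs_from[OF G cub, symmetric]) auto
  also have "{(u, v) \<in> parcs G. u \<in> ?XW} = ?ar ?XW ?XU \<union> ?ar ?XW (-X)"
    using WtoU by auto
  also have "card \<dots> = card (?ar ?XW ?XU) + card (?ar ?XW (-X))"
    by (rule card_Un_disjoint[OF fin fin]) auto
  finally have cW: "3 * card ?XW = card (?ar ?XW ?XU) + card (?ar ?XW (-X))" .
  have "{(u, v) \<in> parcs G. u \<in> X \<and> v \<notin> X} = ?ar ?XU (-X) \<union> ?ar ?XW (-X)"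
    using arcs by auto
  also have "card \<dots> = card (?ar ?XU (-X)) + card (?ar ?XW (-X))"
    by (rule card_Un_disjoint[OF fin fin]) (use UW(2) in auto)
  finally have cut: "card {(u, v) \<in> parcs G. u \<in> X \<and> v \<notin> X} =
      card (?ar ?XU (-X)) + card (?ar ?XW (-X))" .
  have "finite {(u, v) \<in> parcs G. u \<in> X \<and> v \<notin> X}" 
    by (rule finite_subset[OF _ pair_finite_arcs]) auto
  then have "card {(u, v) \<in> parcs G. u \<in> X \<and> v \<notin> X} \<noteq> 0"
    using connected_cut_nonempty[OF G conn X] by simp
  then show ?thesis
    using cU cW cut card_arcs_between_sym[OF G, of ?XU ?XW] by presburger
qed

lemma sum_arcs_as_double_sum:
  fixes f :: "nat \<Rightarrow> nat \<Rightarrow> real"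
  assumes "A \<subseteq> {0..<N} \<times> {0..<N}"
  shows "(\<Sum>(i, j)\<in>A. f i j) = (\<Sum>i<N. \<Sum>j<N. if (i, j) \<in> A then f i j else 0)"
proof -
  have "(\<Sum>i<N. \<Sum>j<N. if (i, j) \<in> A then f i j else 0) =
      (\<Sum>e\<in>{..<N} \<times> {..<N}. if e \<in> A then f (fst e) (snd e) else 0)"
    by (simp add: sum.cartesian_product case_prod_unfold)
  also have "\<dots> = (\<Sum>e\<in>{e \<in> {..<N} \<times> {..<N}. e \<in> A}. f (fst e) (snd e))"
    by (rule sum.inter_filter[symmetric]) simp
  also have "{e \<in> {..<N} \<times> {..<N}. e \<in> A} = A" using assms by auto
  finally show ?thesis by (simp add: case_prod_unfold)
qed

lemma laplacian_mat_carrier: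
  assumes "pverts G = {0..<N}"
  shows "laplacian_mat G \<in> carrier_mat N N"
  unfolding laplacian_mat_def adjacency_mat_def degree_mat_def
  using assms by (intro minus_carrier_mat) simp

lemma laplacian_mat_sym:
  assumes "pair_graph G"
  shows "transpose_mat (laplacian_mat G) = laplacian_mat G"
proof -
  interpret pair_graph G by fact
  show ?thesis
    by (rule eq_matI)
      (auto simp: laplacian_mat_def adjacency_mat_def degree_mat_def intro: arcs_symmetric)
qed

text \<open>
Every edge contributes two arcs, whence the factor 1/2.
\<close>

lemma laplacian_quadratic_form:
  assumes G: "pair_graph G" and V: "pverts G = {0..<N}" and x: "x \<in> carrier_vec N"
  shows "x \<bullet> (laplacian_mat G *\<^sub>v x) = (\<Sum>(i, j)\<in>parcs G. (x $ i - x $ j)\<^sup>2) / 2"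
proof -
  interpret pair_graph G by fact
  let ?A = "parcs G"
  have AN: "?A \<subseteq> {0..<N} \<times> {0..<N}" using in_arcsD1 in_arcsD2 V by auto
  have deg: "real (vertex_degree G i) = (\<Sum>j<N. if (i, j) \<in> ?A then 1 else 0)" for i
  proof -
    have "{w. (i, w) \<in> ?A} = {j \<in> {..<N}. (i, j) \<in> ?A}" using AN by auto
    then show ?thesis unfolding vertex_degree_eq_card_neighbours
      by (simp add: sum.inter_filter[symmetric])
  qed
  have row: "(laplacian_mat G *\<^sub>v x) $ i = (\<Sum>j<N. if (i, j) \<in> ?A then x $ i - x $ j else 0)"
    if i: "i < N" for i
  proof -
    have "(laplacian_mat G *\<^sub>v x) $ i =
        (\<Sum>j<N. ((if i = j then real (vertex_degree G i) else 0) - (if (i, j) \<in> ?A then 1 else 0)) * x $ j)"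
      using i x V by (simp add: laplacian_mat_def adjacency_mat_def degree_mat_def scalar_prod_def
          lessThan_atLeast0)
    also have "\<dots> = (\<Sum>j<N. (if i = j then real (vertex_degree G i) * x $ i else 0)
        - (if (i, j) \<in> ?A then x $ j else 0))"
      by (rule sum.cong) (auto simp: left_diff_distrib)
    also have "\<dots> = real (vertex_degree G i) * x $ i - (\<Sum>j<N. if (i, j) \<in> ?A then x $ j else 0)"
      using i by (simp add: sum_subtractf)
    also have "\<dots> = (\<Sum>j<N. (if (i, j) \<in> ?A then 1 else 0) * x $ i - (if (i, j) \<in> ?A then x $ j else 0))"
      by (simp add: deg sum_distrib_right sum_subtractf)
    also have "\<dots> = (\<Sum>j<N. if (i, j) \<in> ?A then x $ i - x $ j else 0)"
      by (rule sum.cong) auto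
    finally show ?thesis .
  qed
  have "x \<bullet> (laplacian_mat G *\<^sub>v x) = (\<Sum>i<N. x $ i * (laplacian_mat G *\<^sub>v x) $ i)"
    using laplacian_mat_carrier[OF V] by (simp add: scalar_prod_def lessThan_atLeast0)
  also have "\<dots> = (\<Sum>i<N. \<Sum>j<N. if (i, j) \<in> ?A then x $ i * (x $ i - x $ j) else 0)"
    by (rule sum.cong) (auto simp: row sum_distrib_left intro!: sum.cong)
  also have "\<dots> = (\<Sum>(i, j)\<in>?A. x $ i * (x $ i - x $ j))"
    by (rule sum_arcs_as_double_sum[OF AN, symmetric])
  finally have 1: "x \<bullet> (laplacian_mat G *\<^sub>v x) = (\<Sum>(i, j)\<in>?A. x $ i * (x $ i - x $ j))" .
  have "(\<Sum>(i, j)\<in>?A. x $ i * (x $ i - x $ j)) = (\<Sum>(i, j)\<in>?A. x $ j * (x $ j - x $ i))"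
    by (rule sum.reindex_bij_witness[of _ prod.swap prod.swap]) (auto intro: arcs_symmetric)
  then have "2 * (\<Sum>(i, j)\<in>?A. x $ i * (x $ i - x $ j)) =
      (\<Sum>e\<in>?A. (case e of (i, j) \<Rightarrow> x $ i * (x $ i - x $ j)) + (case e of (i, j) \<Rightarrow> x $ j * (x $ j - x $ i)))"
    by (simp add: sum.distrib)
  also have "\<dots> = (\<Sum>(i, j)\<in>?A. (x $ i - x $ j)\<^sup>2)"
    by (rule sum.cong) (auto simp: power2_eq_square algebra_simps)
  finally show ?thesis using 1 by simp
qed

section \<open>Lower bound\<close>

lemma sorting_enumeration:
  fixes f :: "nat \<Rightarrow> real"
  obtains \<sigma> where "bij_betw \<sigma> {..<N} {0..<N}" "\<And>i j. i \<le> j \<Longrightarrow> j < N \<Longrightarrow> f (\<sigma> i) \<le> f (\<sigma> j)"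
proof (rule that)
  let ?l = "sort_key f [0..<N]"
  show "bij_betw (\<lambda>i. ?l ! i) {..<N} {0..<N}"
    by (rule bij_betw_nth) auto
  show "f (?l ! i) \<le> f (?l ! j)" if "i \<le> j" "j < N" for i j
    using sorted_nth_mono[of "map f ?l" i j] that by simp
qed

text \<open>
For \<open>v\<close> orthogonal to the constants, the sum of the \<open>(v i - c)\<^sup>2\<close> is
smallest at \<open>c = 0\<close>, so the value of \<open>v\<close> at the middle position may serve
as the centre and \<open>two_sided_energy\<close> applies to the sorted values.
\<close>

lemma algebraic_connectivity_ge:
  assumes G: "G \<in> connected_cubic_bipartite_graphs (2 * n)" and n: "1 \<le> n"
    and p: "1 \<le> p" and m: "1 \<le> m" and nmp: "n \<le> m * p"
  shows "path_bound p m \<le> algebraic_connectivity G"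
proof -
  let ?N = "2 * n" and ?A = "parcs G"
  have gr: "pair_graph G" and V: "pverts G = {0..<?N}" and cub: "cubic G" and bip: "bipartite G"
    and conn: "Digraph_Component.connected (with_proj G)"
    using G by (auto simp: connected_cubic_bipartite_graphs_def)
  interpret pair_graph G by fact
  let ?one = "vec ?N (\<lambda>_. 1) :: real vec"
  show ?thesis unfolding algebraic_connectivity_def
  proof (rule le_second_eigenvalue[OF laplacian_mat_carrier[OF V] laplacian_mat_sym[OF gr]])
    show "2 \<le> ?N" using n by simp
    show "?one \<in> carrier_vec ?N" by simp
    fix v :: "real vec" assume v: "v \<in> carrier_vec ?N" and orth: "v \<bullet> ?one = 0"
    obtain \<sigma> where bij: "bij_betw \<sigma> {..<?N} {0..<?N}"
      and srt: "\<And>i j. i \<le> j \<Longrightarrow> j < ?N \<Longrightarrow> v $ (\<sigma> i) \<le> v $ (\<sigma> j)"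
      using sorting_enumeration[of ?N "\<lambda>i. v $ i"] by blast
    have \<sigma>N: "\<sigma> i < ?N" if "i < ?N" for i using bij_betwE[OF bij] that by auto
    have \<sigma>inj: "\<sigma> i = \<sigma> j \<longleftrightarrow> i = j" if "i < ?N" "j < ?N" for i j
      using bij_betw_imp_inj_on[OF bij] that by (auto simp: inj_on_def)
    have \<sigma>surj: "\<exists>i. y = \<sigma> i \<and> i < ?N" if "y \<in> {0..<?N}" for y
      using bij_betw_imp_surj_on[OF bij] that by blast
    define x where "x i = v $ \<sigma> i" for i
    define E where "E = {(i, j). i < j \<and> j < ?N \<and> (\<sigma> i, \<sigma> j) \<in> ?A}"
    let ?\<sigma>\<sigma> = "map_prod \<sigma> \<sigma>"
    have energy: "path_bound p m * (\<Sum>i\<le>?N - 1. (x i - x n)\<^sup>2) \<le> (\<Sum>e\<in>E. (x (snd e) - x (fst e))\<^sup>2)"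
    proof (rule two_sided_energy[OF _ _ _ _ p m])
      show "fst e < snd e \<and> snd e \<le> ?N - 1" if "e \<in> E" for e using that by (auto simp: E_def)
      show "card {e \<in> E. fst e = w \<or> snd e = w} \<le> 3" if w: "w \<le> ?N - 1" for w
      proof -
        have wN: "w < ?N" using w n by simp
        let ?nb = "{j. j < ?N \<and> (\<sigma> w, \<sigma> j) \<in> ?A}"
        have fin: "finite ?nb" by simp
        have "{e \<in> E. fst e = w \<or> snd e = w} \<subseteq> (\<lambda>j. (min w j, max w j)) ` ?nb"
        proof
          fix e assume "e \<in> {e \<in> E. fst e = w \<or> snd e = w}"
          then have "(if fst e = w then snd e else fst e) \<in> ?nb \<and>
              e = (min w (if fst e = w then snd e else fst e), max w (if fst e = w then snd e else fst e))"
            using wN by (cases e) (auto simp: E_def min_def max_def dest: arcs_symmetric)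
          then show "e \<in> (\<lambda>j. (min w j, max w j)) ` ?nb" by blast
        qed
        then have "card {e \<in> E. fst e = w \<or> snd e = w} \<le> card ?nb"
          using fin by (meson card_image_le card_mono finite_imageI le_trans)
        also have "\<dots> \<le> card {y. (\<sigma> w, y) \<in> ?A}"
        proof (rule card_inj_on_le)
          show "inj_on \<sigma> ?nb" using \<sigma>inj by (auto simp: inj_on_def)
          show "finite {y. (\<sigma> w, y) \<in> ?A}"
          proof (rule finite_subset)
            show "{y. (\<sigma> w, y) \<in> ?A} \<subseteq> {0..<?N}" using in_arcsD2 V by auto
          qed simp
        qed auto
        also have "\<dots> = 3"
          using cub V \<sigma>N[OF wN] by (simp add: cubic_def vertex_degree_eq_card_neighbours)
        finally show ?thesis .
      qed
      show "2 \<le> card (crossing E k)" if k: "k < ?N - 1" for k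
      proof -
        let ?X = "\<sigma> ` {..k}"
        have kN: "Suc k < ?N" using k by simp
        have XV: "?X \<subseteq> pverts G" using \<sigma>N kN V by auto
        have "\<sigma> (Suc k) \<notin> ?X" using \<sigma>inj kN by auto
        moreover have "\<sigma> (Suc k) \<in> pverts G" using \<sigma>N kN V by auto
        ultimately have X: "?X \<noteq> pverts G" by blast
        have "{(a, b) \<in> ?A. a \<in> ?X \<and> b \<notin> ?X} \<subseteq> ?\<sigma>\<sigma> ` crossing E k"
        proof
          fix e assume "e \<in> {(a, b) \<in> ?A. a \<in> ?X \<and> b \<notin> ?X}"
          then obtain i b where e: "e = (\<sigma> i, b)" "(\<sigma> i, b) \<in> ?A" "i \<le> k" "b \<notin> ?X" by auto
          have "b \<in> {0..<?N}" using e in_arcsD2 V by blast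
          then obtain j where j: "b = \<sigma> j" "j < ?N"
            using \<sigma>surj by meson
          then have "k < j" using e by (meson atMost_iff imageI not_le)
          then have "(i, j) \<in> crossing E k" using e j by (simp add: crossing_def E_def)
          then show "e \<in> ?\<sigma>\<sigma> ` crossing E k" using e(1) j(1)
            by (intro image_eqI[of _ _ "(i, j)"]) auto
        qed
        moreover have "finite (crossing E k)"
        proof (rule finite_subset)
          show "crossing E k \<subseteq> {..<?N} \<times> {..<?N}" by (auto simp: crossing_def E_def)
        qed simp
        ultimately have "card {(a, b) \<in> ?A. a \<in> ?X \<and> b \<notin> ?X} \<le> card (crossing E k)"
          by (meson card_image_le card_mono finite_imageI le_trans)
        moreover have "2 \<le> card {(a, b) \<in> ?A. a \<in> ?X \<and> b \<notin> ?X}"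
          by (rule cubic_bipartite_cut[OF gr conn cub bip XV _ X]) auto
        ultimately show ?thesis by simp
      qed
      show "x i \<le> x j" if "i \<le> j" "j \<le> ?N - 1" for i j
        unfolding x_def using that n by (intro srt) auto
    qed (use n nmp in auto)
    have posarcs: "?A = ?\<sigma>\<sigma> ` (E \<union> prod.swap ` E)"
    proof
      show "?A \<subseteq> ?\<sigma>\<sigma> ` (E \<union> prod.swap ` E)"
      proof
        fix e assume e: "e \<in> ?A"
        then have "fst e \<in> {0..<?N}" "snd e \<in> {0..<?N}" using V wellformed by auto
        then obtain i j where "fst e = \<sigma> i" "snd e = \<sigma> j" and ij: "i < ?N" "j < ?N"
          using \<sigma>surj by meson
        then have e': "e = (\<sigma> i, \<sigma> j)" by (simp add: prod_eq_iff)
        then have "i \<noteq> j" using e no_loops' by auto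
        then have "(i, j) \<in> E \<or> (j, i) \<in> E" using e e' ij by (auto simp: E_def dest: arcs_symmetric)
        then have "(i, j) \<in> E \<union> prod.swap ` E" by (metis UnI1 UnI2 image_eqI swap_simp)
        then show "e \<in> ?\<sigma>\<sigma> ` (E \<union> prod.swap ` E)" 
          by (rule image_eqI[of _ _ "(i, j)", rotated]) (simp add: e')
      qed
      show "?\<sigma>\<sigma> ` (E \<union> prod.swap ` E) \<subseteq> ?A" by (auto simp: E_def dest: arcs_symmetric)
    qed
    have inj: "inj_on ?\<sigma>\<sigma> (E \<union> prod.swap ` E)" using \<sigma>inj by (auto simp: inj_on_def E_def)
    have finE: "finite E" by (rule finite_subset[of _ "{..<?N} \<times> {..<?N}"]) (auto simp: E_def)
    have "(\<Sum>(i, j)\<in>?A. (v $ i - v $ j)\<^sup>2) = (\<Sum>(i, j)\<in>E \<union> prod.swap ` E. (x i - x j)\<^sup>2)"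
      unfolding posarcs sum.reindex[OF inj] by (simp add: x_def case_prod_unfold o_def)
    also have "\<dots> = (\<Sum>(i, j)\<in>E. (x i - x j)\<^sup>2) + (\<Sum>(i, j)\<in>prod.swap ` E. (x i - x j)\<^sup>2)"
      using finE by (intro sum.union_disjoint) (auto simp: E_def)
    also have "(\<Sum>(i, j)\<in>prod.swap ` E. (x i - x j)\<^sup>2) = (\<Sum>(i, j)\<in>E. (x j - x i)\<^sup>2)"
      by (subst sum.reindex) (auto simp: case_prod_unfold inj_on_def intro!: sum.cong)
    also have "(\<Sum>(i, j)\<in>E. (x i - x j)\<^sup>2) + (\<Sum>(i, j)\<in>E. (x j - x i)\<^sup>2) = 2 * (\<Sum>e\<in>E. (x (snd e) - x (fst e))\<^sup>2)"
      by (simp add: case_prod_unfold power2_commute[of "x (fst _)"])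
    finally have quad: "v \<bullet> (laplacian_mat G *\<^sub>v v) = (\<Sum>e\<in>E. (x (snd e) - x (fst e))\<^sup>2)"
      using laplacian_quadratic_form[OF gr V v] by simp
    have "(\<Sum>i<?N. x i) = (\<Sum>i\<in>{0..<?N}. v $ i)"
      unfolding x_def by (rule sum.reindex_bij_betw[OF bij])
    then have mean: "(\<Sum>i<?N. x i) = 0" using orth v by (simp add: scalar_prod_def)
    have "v \<bullet> v = (\<Sum>i\<in>{0..<?N}. (v $ i)\<^sup>2)" using v by (simp add: scalar_prod_def power2_eq_square)
    also have "\<dots> = (\<Sum>i<?N. (x i)\<^sup>2)"
      unfolding x_def by (rule sum.reindex_bij_betw[OF bij, symmetric])
    also have "\<dots> \<le> (\<Sum>i<?N. (x i)\<^sup>2) + ?N * (x n)\<^sup>2" by simp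
    also have "\<dots> = (\<Sum>i<?N. (x i - x n)\<^sup>2)"
      using mean by (simp add: power2_diff sum.distrib sum_subtractf sum_distrib_left[symmetric]
          sum_distrib_right[symmetric])
    also have "{..<?N} = {..?N - 1}" using n by auto
    finally have "path_bound p m * (v \<bullet> v) \<le> path_bound p m * (\<Sum>i\<le>?N - 1. (x i - x n)\<^sup>2)"
      by (intro mult_left_mono path_bound_nonneg)
    then show "path_bound p m * (v \<bullet> v) \<le> v \<bullet> (laplacian_mat G *\<^sub>v v)"
      using energy quad by simp
  qed
qed

section \<open>Upper bound: a ladder with two caps\<close>

text \<open>
The ladder as the bipartite double cover of a path with a loop at each layer: vertex \<open>2 i +
s\<close> is the copy of layer \<open>i\<close> on side \<open>s\<close>, and edges join opposite
sides of adjacent layers, a loop being a rung. Without the rung in layer 2 and with edges between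
layers 0 and 2, layers 0, 1 and 2 span \<open>K\<^sub>3\<^sub>,\<^sub>3\<close> minus an edge;
likewise at the other end.
\<close>

definition layer_adj :: "nat \<Rightarrow> nat \<Rightarrow> nat \<Rightarrow> bool" where
  "layer_adj n i j \<longleftrightarrow>
     i = j \<and> i \<noteq> 2 \<and> i \<noteq> n - 3 \<or> j = Suc i \<or> i = Suc j \<or>
     i = 0 \<and> j = 2 \<or> i = 2 \<and> j = 0 \<or> i = n - 3 \<and> j = n - 1 \<or> i = n - 1 \<and> j = n - 3"

definition capped_ladder :: "nat \<Rightarrow> nat pair_pre_digraph" where
  "capped_ladder n = \<lparr>pverts = {0..<2*n},
     parcs = {(u, v). u < 2*n \<and> v < 2*n \<and> u mod 2 \<noteq> v mod 2 \<and> layer_adj n (u div 2) (v div 2)}\<rparr>"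

lemma layer_adj_sym: "layer_adj n i j \<longleftrightarrow> layer_adj n j i"
  unfolding layer_adj_def by auto

lemma pverts_capped_ladder [simp]: "pverts (capped_ladder n) = {0..<2*n}"
  by (simp add: capped_ladder_def)

lemma capped_ladder_arc_iff:
  "(u, v) \<in> parcs (capped_ladder n) \<longleftrightarrow>
     u < 2*n \<and> v < 2*n \<and> u mod 2 \<noteq> v mod 2 \<and> layer_adj n (u div 2) (v div 2)"
  by (simp add: capped_ladder_def)

lemma pair_graph_capped_ladder: "pair_graph (capped_ladder n)"
proof
  have "parcs (capped_ladder n) \<subseteq> {..<2*n} \<times> {..<2*n}" by (auto simp: capped_ladder_arc_iff)
  then show "finite (parcs (capped_ladder n))" by (rule finite_subset) simp
  show "symmetric (with_proj (capped_ladder n))"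
    unfolding symmetric_def by (auto simp: capped_ladder_arc_iff layer_adj_sym intro!: symI)
qed (auto simp: capped_ladder_arc_iff)

lemma card_layer_adj:
  assumes n: "7 \<le> n" and i: "i < n"
  shows "card {j. j < n \<and> layer_adj n i j} = 3"
proof -
  obtain k where k: "n = k + 7" using n by (metis add.commute le_Suc_ex)
  have ends: "n - 3 = k + 4" "n - 1 = k + 6" by (simp_all add: k)
  let ?S = "{j. j < n \<and> layer_adj n i j}"
  have adj: "layer_adj n i j \<longleftrightarrow> i = j \<and> i \<noteq> 2 \<and> i \<noteq> k + 4 \<or> j = Suc i \<or> i = Suc j \<or>
      i = 0 \<and> j = 2 \<or> i = 2 \<and> j = 0 \<or> i = k + 4 \<and> j = k + 6 \<or> i = k + 6 \<and> j = k + 4" for j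
    unfolding layer_adj_def ends by (rule refl)
  have three: "card {a, b, c} = 3" if "a < b" "b < c" for a b c :: nat
    using that by auto
  consider "i \<le> 1" | "i = 2" | "3 \<le> i" "i \<le> k + 3" | "i = k + 4" | "i = k + 5" | "i = k + 6"
    using i k by linarith
  then show ?thesis
  proof cases
    case 1
    then have "?S = {0, 1, 2}" unfolding adj unfolding k by auto
    then show ?thesis using three[of 0 1 2] by simp
  next
    case 2
    then have "?S = {0, 1, 3}" unfolding adj unfolding k by auto
    then show ?thesis using three[of 0 1 3] by simp
  next
    case 3
    then have "?S = {i - 1, i, i + 1}" unfolding adj unfolding k by auto
    then show ?thesis using three[of "i - 1" i "i + 1"] 3 by simp
  next
    case 4
    then have "?S = {k + 3, k + 5, k + 6}" unfolding adj unfolding k by auto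
    then show ?thesis using three[of "k + 3" "k + 5" "k + 6"] by simp
  next
    case 5
    then have "?S = {k + 4, k + 5, k + 6}" unfolding adj unfolding k by auto
    then show ?thesis using three[of "k + 4" "k + 5" "k + 6"] by simp
  next
    case 6
    then have "?S = {k + 4, k + 5, k + 6}" unfolding adj unfolding k by auto
    then show ?thesis using three[of "k + 4" "k + 5" "k + 6"] by simp
  qed
qed

lemma cubic_capped_ladder:
  assumes "7 \<le> n"
  shows "cubic (capped_ladder n)"
  unfolding cubic_def
proof
  fix v assume "v \<in> pverts (capped_ladder n)"
  then have v: "v div 2 < n" "v < 2 * n" by auto
  let ?f = "\<lambda>j. 2 * j + (1 - v mod 2)"
  have "{w. (v, w) \<in> parcs (capped_ladder n)} = ?f ` {j. j < n \<and> layer_adj n (v div 2) j}"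
  proof
    show "{w. (v, w) \<in> parcs (capped_ladder n)} \<subseteq> ?f ` {j. j < n \<and> layer_adj n (v div 2) j}"
    proof
      fix w assume "w \<in> {w. (v, w) \<in> parcs (capped_ladder n)}"
      then have w: "w < 2 * n" "v mod 2 \<noteq> w mod 2" "layer_adj n (v div 2) (w div 2)"
        by (auto simp: capped_ladder_arc_iff)
      have "w mod 2 = 1 - v mod 2" using w(2) by (cases "v mod 2 = 0") auto
      then have "w = ?f (w div 2)" by (metis mult_div_mod_eq)
      then show "w \<in> ?f ` {j. j < n \<and> layer_adj n (v div 2) j}" using w by auto
    qed
    show "?f ` {j. j < n \<and> layer_adj n (v div 2) j} \<subseteq> {w. (v, w) \<in> parcs (capped_ladder n)}"
    proof
      fix w assume "w \<in> ?f ` {j. j < n \<and> layer_adj n (v div 2) j}"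
      then obtain j where j: "j < n" "layer_adj n (v div 2) j" "w = ?f j" by auto
      have "w div 2 = j \<and> v mod 2 \<noteq> w mod 2 \<and> w < 2 * n"
        using j by (cases "v mod 2 = 0") auto
      then show "w \<in> {w. (v, w) \<in> parcs (capped_ladder n)}" using j v
        by (auto simp: capped_ladder_arc_iff)
    qed
  qed
  moreover have "inj_on ?f A" for A by (auto simp: inj_on_def)
  ultimately show "vertex_degree (capped_ladder n) v = 3"
    using card_layer_adj[OF assms v(1)] by (simp add: vertex_degree_eq_card_neighbours card_image)
qed

lemma bipartite_capped_ladder: "bipartite (capped_ladder n)"
  unfolding bipartite_def
  by (rule exI[of _ "{u \<in> {0..<2*n}. u mod 2 = 0}"], rule exI[of _ "{u \<in> {0..<2*n}. u mod 2 \<noteq> 0}"])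
    (auto simp: capped_ladder_arc_iff)

lemma connected_capped_ladder:
  assumes n: "7 \<le> n"
  shows "Digraph_Component.connected (with_proj (capped_ladder n))"
proof -
  let ?G = "capped_ladder n"
  interpret pair_graph ?G by (rule pair_graph_capped_ladder)
  have from0: "(0, 2 * i + s) \<in> (parcs ?G)\<^sup>*" if "i < n" "s < 2" for i s
    using that
  proof (induction i arbitrary: s)
    case 0
    then have "s = 0 \<or> s = 1" by auto
    moreover have "(0, 1) \<in> parcs ?G" using n by (auto simp: capped_ladder_arc_iff layer_adj_def)
    ultimately show ?case by auto
  next
    case (Suc i)
    have "(0, 2 * i + (1 - s)) \<in> (parcs ?G)\<^sup>*"
      using Suc.prems by (intro Suc.IH) auto
    moreover have "s = 0 \<or> s = 1" using Suc.prems(2) by auto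
    then have "(2 * i + (1 - s)) div 2 = i" "(2 * Suc i + s) div 2 = Suc i"
        "(2 * i + (1 - s)) mod 2 \<noteq> (2 * Suc i + s) mod 2"
      by auto
    then have "(2 * i + (1 - s), 2 * Suc i + s) \<in> parcs ?G"
      using Suc.prems unfolding capped_ladder_arc_iff layer_adj_def by auto
    ultimately show ?case by (rule rtrancl_into_rtrancl)
  qed
  have reach0: "(0, v) \<in> (parcs ?G)\<^sup>*" if "v < 2 * n" for v
  proof -
    have "v = 2 * (v div 2) + v mod 2" "v div 2 < n" "v mod 2 < 2" using that by auto
    then show ?thesis using from0 by metis
  qed
  have symA: "sym (parcs ?G)" by (auto intro: symI arcs_symmetric)
  have "(u, v) \<in> (parcs ?G)\<^sup>*" if "u < 2 * n" "v < 2 * n" for u v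
    using reach0[OF that(1)] reach0[OF that(2)] sym_rtrancl[OF symA] by (meson rtrancl_trans symD)
  then have "(u, v) \<in> rtrancl_on (pverts ?G) (parcs ?G)" if "u < 2 * n" "v < 2 * n" for u v
    using that in_arcsD2 by (intro rtrancl_consistent_rtrancl_on) auto
  then have "u \<rightarrow>\<^sup>*\<^bsub>with_proj ?G\<^esub> v" if "u < 2 * n" "v < 2 * n" for u v
    using that unfolding reachable_def by simp
  then have "u \<rightarrow>\<^sup>*\<^bsub>with_proj (mk_symmetric (with_proj ?G))\<^esub> v" if "u < 2 * n" "v < 2 * n" for u v
    using that reachable_mk_symmetricI by blast
  then show ?thesis using n
    unfolding Digraph_Component.connected_def strongly_connected_def by auto
qed

lemma capped_ladder_mem:
  assumes "7 \<le> n"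
  shows "capped_ladder n \<in> connected_cubic_bipartite_graphs (2 * n)"
  using assms pair_graph_capped_ladder connected_capped_ladder cubic_capped_ladder
    bipartite_capped_ladder by (simp add: connected_cubic_bipartite_graphs_def)

text \<open>
The shift by 1/2 puts the reflection points of the cosine midway before the first and after the last
layer, so \<open>c\<close> is an eigenvector of the path with both ends free; the sum is evaluated
by summation by parts.
\<close>

lemma cosine_energy:
  fixes m :: nat
  assumes m: "1 \<le> m"
  defines "\<theta> \<equiv> pi / real m"
  defines "c \<equiv> \<lambda>k::nat. cos (\<theta> * (real k + 1/2))"
  shows "(\<Sum>k<m - 1. (c (Suc k) - c k)\<^sup>2) = (2 - 2 * cos \<theta>) * (\<Sum>k<m. (c k)\<^sup>2)"
proof -
  have c1: "c 1 = (2 * cos \<theta> - 1) * c 0"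
  proof -
    have "c 1 + c 0 = cos (\<theta> / 2 + \<theta>) + cos (\<theta> / 2 - \<theta>)"
    proof -
      have "cos (\<theta> / 2 - \<theta>) = cos (\<theta> / 2)" by (subst cos_minus[symmetric]) simp
      then show ?thesis by (simp add: c_def algebra_simps)
    qed
    also have "\<dots> = 2 * cos \<theta> * cos (\<theta> / 2)" unfolding cos_add cos_diff by simp
    also have "cos (\<theta> / 2) = c 0" by (simp add: c_def)
    finally show ?thesis by (simp add: algebra_simps)
  qed
  have rec: "c (Suc (Suc k)) = 2 * cos \<theta> * c (Suc k) - c k" for k
  proof -
    have "c (Suc (Suc k)) + c k = cos (\<theta> * (real (Suc k) + 1/2) + \<theta>) + cos (\<theta> * (real (Suc k) + 1/2) - \<theta>)"
      by (simp add: c_def algebra_simps)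
    also have "\<dots> = 2 * cos \<theta> * c (Suc k)" by (simp add: cos_add cos_diff c_def)
    finally show ?thesis by simp
  qed
  have partial: "(\<Sum>k<M. (c (Suc k) - c k)\<^sup>2) =
      (2 - 2 * cos \<theta>) * (\<Sum>k<Suc M. (c k)\<^sup>2) + c M * (c (Suc M) - c M)" for M
  proof (induction M)
    case 0
    have "c (Suc 0) = (2 * cos \<theta> - 1) * c 0" using c1 by simp
    then show ?case by (simp only:) (simp add: power2_eq_square algebra_simps)
  next
    case (Suc M)
    have "(\<Sum>k<Suc M. (c (Suc k) - c k)\<^sup>2) = (\<Sum>k<M. (c (Suc k) - c k)\<^sup>2) + (c (Suc M) - c M)\<^sup>2"
      by simp
    also have "\<dots> = (2 - 2 * cos \<theta>) * (\<Sum>k<Suc M. (c k)\<^sup>2) + c M * (c (Suc M) - c M) + (c (Suc M) - c M)\<^sup>2"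
      by (simp only: Suc)
    also have "\<dots> = (2 - 2 * cos \<theta>) * (\<Sum>k<Suc (Suc M). (c k)\<^sup>2) + c (Suc M) * (c (Suc (Suc M)) - c (Suc M))"
      unfolding rec sum.lessThan_Suc[of _ "Suc M"] by (simp only: power2_eq_square algebra_simps) 
    finally show ?case .
  qed
  have "c m = c (m - 1)"
  proof -
    have "\<theta> * real m = pi" using m by (simp add: \<theta>_def)
    then have "\<theta> * (real m + 1/2) = pi + \<theta> / 2" "\<theta> * (real (m - 1) + 1/2) = pi - \<theta> / 2"
      using m by (auto simp: algebra_simps of_nat_diff)
    then show ?thesis by (simp add: c_def cos_add cos_diff)
  qed
  then show ?thesis using partial[of "m - 1"] m by simp
qed

lemma sum_arcs_capped_ladder:
  fixes F :: "nat \<Rightarrow> nat \<Rightarrow> real"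
  shows "(\<Sum>(u, v)\<in>parcs (capped_ladder n). F (u div 2) (v div 2)) =
    2 * (\<Sum>(i, j)\<in>{(i, j). i < n \<and> j < n \<and> layer_adj n i j}. F i j)"
proof -
  let ?L = "{(i, j). i < n \<and> j < n \<and> layer_adj n i j}"
  have "(\<Sum>(u, v)\<in>parcs (capped_ladder n). F (u div 2) (v div 2)) =
      (\<Sum>(s, e)\<in>{0, 1::nat} \<times> ?L. F (fst e) (snd e))"
  proof (rule sum.reindex_bij_witness[of _ "\<lambda>(s, (i, j)). (2 * i + s, 2 * j + (1 - s))"
        "\<lambda>(u, v). (u mod 2, (u div 2, v div 2))"])
    fix e assume "e \<in> parcs (capped_ladder n)"
    then obtain u v where e: "e = (u, v)" "u < 2*n" "v < 2*n" "u mod 2 \<noteq> v mod 2"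
      "layer_adj n (u div 2) (v div 2)" by (cases e) (auto simp: capped_ladder_arc_iff)
    have "v mod 2 = 1 - u mod 2" using e(4) by (cases "u mod 2 = 0") auto
    then have "2 * (u div 2) + u mod 2 = u" "2 * (v div 2) + (1 - u mod 2) = v"
      by (metis mult_div_mod_eq)+
    then show "(case case e of (u, v) \<Rightarrow> (u mod 2, u div 2, v div 2) of
           (s, i, j) \<Rightarrow> (2 * i + s, 2 * j + (1 - s))) = e" using e(1) by simp
    show "(case e of (u, v) \<Rightarrow> (u mod 2, u div 2, v div 2)) \<in> {0, 1} \<times> ?L"
      using e by auto
    show "(case case e of (u, v) \<Rightarrow> (u mod 2, u div 2, v div 2) of (s, e) \<Rightarrow> F (fst e) (snd e)) =
         (case e of (u, v) \<Rightarrow> F (u div 2) (v div 2))" using e by simp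
  next
    fix e assume "e \<in> {0, 1::nat} \<times> ?L"
    then obtain s i j where e: "e = (s, (i, j))" "s < 2" "i < n" "j < n" "layer_adj n i j" by auto
    then have "s = 0 \<or> s = 1" by auto
    then have *: "(2 * i + s) mod 2 = s" "(2 * i + s) div 2 = i" "(2 * j + (1 - s)) div 2 = j"
      "(2 * j + (1 - s)) mod 2 \<noteq> s" "2 * i + s < 2 * n" "2 * j + (1 - s) < 2 * n"
      using e(3,4) by auto
    then show "(case case e of (s, i, j) \<Rightarrow> (2 * i + s, 2 * j + (1 - s)) of
           (u, v) \<Rightarrow> (u mod 2, u div 2, v div 2)) = e" using e(1) by simp
    show "(case e of (s, i, j) \<Rightarrow> (2 * i + s, 2 * j + (1 - s))) \<in> parcs (capped_ladder n)"
      using * e by (auto simp: capped_ladder_arc_iff)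
  qed
  also have "\<dots> = (\<Sum>s\<in>{0, 1::nat}. \<Sum>e\<in>?L. F (fst e) (snd e))"
    by (rule sum.cartesian_product[symmetric])
  finally show ?thesis by (simp add: case_prod_unfold)
qed

lemma sum_div_2: "(\<Sum>v<2*n. f (v div 2)) = 2 * (\<Sum>i<n. f i)" for f :: "nat \<Rightarrow> real"
  by (induction n) (simp_all add: algebra_simps)

lemma sum_layer_adj:
  fixes F :: "nat \<Rightarrow> nat \<Rightarrow> real"
  assumes sym: "\<And>i j. F i j = F j i" and diag: "\<And>i. F i i = 0"
    and ends: "F 0 2 = 0" "F (n - 3) (n - 1) = 0"
  shows "(\<Sum>(i, j)\<in>{(i, j). i < n \<and> j < n \<and> layer_adj n i j}. F i j) = 2 * (\<Sum>i<n - 1. F i (Suc i))"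
proof -
  let ?L = "{(i, j). i < n \<and> j < n \<and> layer_adj n i j}"
  let ?up = "(\<lambda>i. (i, Suc i)) ` {..<n - 1}" and ?down = "(\<lambda>i. (Suc i, i)) ` {..<n - 1}"
  have fin: "finite ?L" by (rule finite_subset[of _ "{..<n} \<times> {..<n}"]) auto
  have "(\<Sum>(i, j)\<in>?L. F i j) = (\<Sum>(i, j)\<in>?up \<union> ?down. F i j)"
  proof (rule sum.mono_neutral_right[OF fin])
    show "?up \<union> ?down \<subseteq> ?L" by (auto simp: layer_adj_def)
    show "\<forall>e\<in>?L - (?up \<union> ?down). (case e of (i, j) \<Rightarrow> F i j) = 0"
    proof
      fix e assume e: "e \<in> ?L - (?up \<union> ?down)"
      obtain i j where ij: "e = (i, j)" by (cases e)
      have "j \<noteq> Suc i" "i \<noteq> Suc j" using e ij by auto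
      then have "i = j \<or> i = 0 \<and> j = 2 \<or> i = 2 \<and> j = 0 \<or> i = n - 3 \<and> j = n - 1 \<or> i = n - 1 \<and> j = n - 3"
        using e ij by (auto simp: layer_adj_def)
      then have "F i j = 0" using ends diag sym[of 2 0] sym[of "n - 1" "n - 3"] by auto
      then show "(case e of (i, j) \<Rightarrow> F i j) = 0" using ij by simp
    qed
  qed
  also have "\<dots> = (\<Sum>(i, j)\<in>?up. F i j) + (\<Sum>(i, j)\<in>?down. F i j)"
    by (rule sum.union_disjoint) auto
  also have "(\<Sum>(i, j)\<in>?up. F i j) = (\<Sum>i<n - 1. F i (Suc i))"
    by (subst sum.reindex) (auto simp: inj_on_def)
  also have "(\<Sum>(i, j)\<in>?down. F i j) = (\<Sum>i<n - 1. F i (Suc i))"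
    by (subst sum.reindex) (auto simp: inj_on_def sym[of "Suc _"])
  finally show ?thesis by simp
qed

text \<open>
The test vector is \<open>f (v div 2)\<close>, where \<open>f\<close> is a half period of the cosine
along layers 3 to \<open>n - 4\<close> that is continued constantly on both caps. It is
antisymmetric under reversal of the layers, hence orthogonal to the constants. The edges inside the
caps and those attaching them carry no energy. For \<open>n = 7\<close> the vector would vanish.
\<close>

lemma algebraic_connectivity_capped_ladder_le:
  assumes n: "8 \<le> n"
  shows "algebraic_connectivity (capped_ladder n) \<le> 2 - 2 * cos (pi / real (n - 6))"
proof -
  let ?G = "capped_ladder n" and ?N = "2 * n"
  define m where "m = n - 6"
  have m: "2 \<le> m" "n = m + 6" using n by (auto simp: m_def)
  define \<theta> where "\<theta> = pi / real m"
  define c where "c k = cos (\<theta> * (real k + 1/2))" for k :: nat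
  define g where "g i = min (i - 3) (m - 1)" for i
  define f where "f i = c (g i)" for i
  let ?l = "2 - 2 * cos \<theta>"
  have gr: "pair_graph ?G" by (rule pair_graph_capped_ladder)
  have V: "pverts ?G = {0..<?N}" by simp
  have energy: "(\<Sum>i<n - 1. (f i - f (Suc i))\<^sup>2) \<le> ?l * (\<Sum>i<n. (f i)\<^sup>2)"
  proof -
    have "(\<Sum>i<n - 1. (f i - f (Suc i))\<^sup>2) = (\<Sum>i\<in>{3..<m + 2}. (f i - f (Suc i))\<^sup>2)"
      using m by (intro sum.mono_neutral_right) (auto simp: f_def g_def min_def not_le not_less
          intro!: arg_cong[of _ _ c])
    also have "\<dots> = (\<Sum>i\<in>{0 + 3..<(m - 1) + 3}. (f i - f (Suc i))\<^sup>2)" using m by simp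
    also have "\<dots> = (\<Sum>k\<in>{0..<m - 1}. (f (k + 3) - f (Suc (k + 3)))\<^sup>2)"
      by (rule sum.shift_bounds_nat_ivl)
    also have "\<dots> = (\<Sum>k<m - 1. (c (Suc k) - c k)\<^sup>2)"
      by (rule sum.cong) (auto simp: f_def g_def min_def power2_commute)
    also have "\<dots> = ?l * (\<Sum>k<m. (c k)\<^sup>2)"
      unfolding c_def \<theta>_def using m by (intro cosine_energy) simp
    also have "(\<Sum>k<m. (c k)\<^sup>2) = (\<Sum>k\<in>{0..<m}. (f (k + 3))\<^sup>2)"
      by (rule sum.cong) (auto simp: f_def g_def min_def)
    also have "\<dots> = (\<Sum>i\<in>{0 + 3..<m + 3}. (f i)\<^sup>2)" by (rule sum.shift_bounds_nat_ivl[symmetric])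
    also have "?l * \<dots> \<le> ?l * (\<Sum>i<n. (f i)\<^sup>2)"
      using m by (intro mult_left_mono sum_mono2) auto
    finally show ?thesis .
  qed
  have mean: "(\<Sum>i<n. f i) = 0"
  proof -
    have anti: "f (n - Suc i) = - f i" if "i < n" for i
    proof -
      have "g (n - Suc i) + g i = m - 1" using that m by (auto simp: g_def min_def)
      then have gr: "real (g (n - Suc i)) = real m - 1 - real (g i)" using m by linarith
      then have "\<theta> * (real (g (n - Suc i)) + 1/2) = \<theta> * real m - \<theta> * (real (g i) + 1/2)"
        unfolding gr by (simp add: algebra_simps)
      also have "\<theta> * real m = pi" using m by (simp add: \<theta>_def)
      finally show ?thesis by (simp add: f_def c_def cos_diff)
    qed
    have "(\<Sum>i<n. f i) = (\<Sum>i<n. f (n - Suc i))" by (rule sum.nat_diff_reindex[symmetric])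
    also have "\<dots> = - (\<Sum>i<n. f i)" using anti by (simp add: sum_negf)
    finally show ?thesis by simp
  qed
  have fpos: "0 < (\<Sum>i<n. (f i)\<^sup>2)"
  proof -
    have "\<theta> / 2 < pi / 2" using m by (simp add: \<theta>_def field_simps)
    moreover have "0 < \<theta>" using m by (simp add: \<theta>_def)
    ultimately have "0 < cos (\<theta> / 2)" by (intro cos_gt_zero) auto
    then have "0 < (f 0)\<^sup>2" by (simp add: f_def c_def g_def)
    also have "(f 0)\<^sup>2 \<le> (\<Sum>i<n. (f i)\<^sup>2)" using n by (intro member_le_sum) auto
    finally show ?thesis .
  qed
  define x where "x = vec ?N (\<lambda>v. f (v div 2))"
  define one where "one = vec ?N (\<lambda>_. 1 :: real)"
  have xc: "x \<in> carrier_vec ?N" and onec: "one \<in> carrier_vec ?N" by (simp_all add: x_def one_def)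
  have idx: "(a \<cdot>\<^sub>v one + b \<cdot>\<^sub>v x) $ v = a + b * f (v div 2)" if "v < ?N" for a b v
    using that by (simp add: x_def one_def)
  have comb: "a \<cdot>\<^sub>v one + b \<cdot>\<^sub>v x \<in> carrier_vec ?N" for a b using xc onec by simp
  have norm: "(a \<cdot>\<^sub>v one + b \<cdot>\<^sub>v x) \<bullet> (a \<cdot>\<^sub>v one + b \<cdot>\<^sub>v x) =
      2 * (real n * a\<^sup>2 + b\<^sup>2 * (\<Sum>i<n. (f i)\<^sup>2))" for a b
  proof -
    have "(a \<cdot>\<^sub>v one + b \<cdot>\<^sub>v x) \<bullet> (a \<cdot>\<^sub>v one + b \<cdot>\<^sub>v x) = (\<Sum>v<?N. (a + b * f (v div 2))\<^sup>2)"
      using comb[of a b] by (auto simp: scalar_prod_def idx lessThan_atLeast0 power2_eq_square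
          simp del: index_add_vec index_smult_vec intro!: sum.cong)
    also have "\<dots> = 2 * (\<Sum>i<n. (a + b * f i)\<^sup>2)" by (rule sum_div_2)
    also have "(\<Sum>i<n. (a + b * f i)\<^sup>2) = real n * a\<^sup>2 + 2 * a * b * (\<Sum>i<n. f i) + b\<^sup>2 * (\<Sum>i<n. (f i)\<^sup>2)"
      by (simp add: power2_sum power_mult_distrib sum.distrib sum_distrib_left mult_ac)
    finally show ?thesis by (simp add: mean)
  qed
  have quad: "(a \<cdot>\<^sub>v one + b \<cdot>\<^sub>v x) \<bullet> (laplacian_mat ?G *\<^sub>v (a \<cdot>\<^sub>v one + b \<cdot>\<^sub>v x)) =
      2 * b\<^sup>2 * (\<Sum>i<n - 1. (f i - f (Suc i))\<^sup>2)" for a b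
  proof -
    have "(\<Sum>(u, v)\<in>parcs ?G. ((a \<cdot>\<^sub>v one + b \<cdot>\<^sub>v x) $ u - (a \<cdot>\<^sub>v one + b \<cdot>\<^sub>v x) $ v)\<^sup>2) =
        (\<Sum>(u, v)\<in>parcs ?G. (b * f (u div 2) - b * f (v div 2))\<^sup>2)"
    proof (rule sum.cong[OF refl])
      fix e assume "e \<in> parcs ?G"
      then have "fst e < ?N" "snd e < ?N" by (cases e; auto simp: capped_ladder_arc_iff)+
      then show "(case e of (u, v) \<Rightarrow> ((a \<cdot>\<^sub>v one + b \<cdot>\<^sub>v x) $ u - (a \<cdot>\<^sub>v one + b \<cdot>\<^sub>v x) $ v)\<^sup>2) =
          (case e of (u, v) \<Rightarrow> (b * f (u div 2) - b * f (v div 2))\<^sup>2)"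
        by (simp add: idx case_prod_unfold del: index_add_vec index_smult_vec)
    qed
    also have "\<dots> = 2 * (\<Sum>(i, j)\<in>{(i, j). i < n \<and> j < n \<and> layer_adj n i j}. (b * f i - b * f j)\<^sup>2)"
      by (rule sum_arcs_capped_ladder)
    also have "(\<Sum>(i, j)\<in>{(i, j). i < n \<and> j < n \<and> layer_adj n i j}. (b * f i - b * f j)\<^sup>2) =
        2 * (\<Sum>i<n - 1. (b * f i - b * f (Suc i))\<^sup>2)"
      using m by (intro sum_layer_adj) (auto simp: power2_commute f_def g_def min_def)
    also have "(\<Sum>i<n - 1. (b * f i - b * f (Suc i))\<^sup>2) = b\<^sup>2 * (\<Sum>i<n - 1. (f i - f (Suc i))\<^sup>2)"
      by (simp add: sum_distrib_left power_mult_distrib[symmetric] right_diff_distrib)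
    finally show ?thesis using laplacian_quadratic_form[OF gr V comb[of a b]] by simp
  qed
  have "sorted_eigenvalues (laplacian_mat ?G) ! 1 \<le> ?l"
  proof (rule second_eigenvalue_le[OF laplacian_mat_carrier[OF V] laplacian_mat_sym[OF gr] _ onec xc])
    show "2 \<le> ?N" using n by simp
    fix a b :: real
    show "a \<cdot>\<^sub>v one + b \<cdot>\<^sub>v x \<noteq> 0\<^sub>v ?N" if "a \<noteq> 0 \<or> b \<noteq> 0"
    proof
      assume "a \<cdot>\<^sub>v one + b \<cdot>\<^sub>v x = 0\<^sub>v ?N"
      then have z: "real n * a\<^sup>2 + b\<^sup>2 * (\<Sum>i<n. (f i)\<^sup>2) = 0" using norm[of a b] by simp
      have "0 \<le> real n * a\<^sup>2" "0 \<le> b\<^sup>2 * (\<Sum>i<n. (f i)\<^sup>2)" using fpos by auto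
      then have "real n * a\<^sup>2 = 0" "b\<^sup>2 * (\<Sum>i<n. (f i)\<^sup>2) = 0" using z by linarith+
      then show False using that n fpos by auto
    qed
    have "2 * b\<^sup>2 * (\<Sum>i<n - 1. (f i - f (Suc i))\<^sup>2) \<le> 2 * b\<^sup>2 * (?l * (\<Sum>i<n. (f i)\<^sup>2))"
      by (intro mult_left_mono energy) simp
    also have "\<dots> \<le> ?l * (2 * (real n * a\<^sup>2 + b\<^sup>2 * (\<Sum>i<n. (f i)\<^sup>2)))"
    proof -
      have "0 \<le> ?l * (2 * (real n * a\<^sup>2))" by (intro mult_nonneg_nonneg) auto
      then show ?thesis by (simp add: algebra_simps)
    qed
    finally show "(a \<cdot>\<^sub>v one + b \<cdot>\<^sub>v x) \<bullet> (laplacian_mat ?G *\<^sub>v (a \<cdot>\<^sub>v one + b \<cdot>\<^sub>v x))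
        \<le> ?l * ((a \<cdot>\<^sub>v one + b \<cdot>\<^sub>v x) \<bullet> (a \<cdot>\<^sub>v one + b \<cdot>\<^sub>v x))"
      by (simp only: norm quad)
  qed
  then show ?thesis by (simp add: algebraic_connectivity_def \<theta>_def m_def)
qed

section \<open>Asymptotics\<close>

lemma cos_over_square_limit: "((\<lambda>t::real. (2 - 2 * cos t) / t\<^sup>2) \<longlongrightarrow> 1) (at_right 0)"
  by real_asymp

text \<open>
The block length has to tend to infinity, so that \<open>p / (p + 1)\<close> tends to 1, but more
slowly than \<open>n\<close>, so that the rounding to \<open>m\<close> full blocks and the 1 in
\<open>2 m + 1\<close> do not matter. The square root is one such choice. The quotient \<open>r
n\<close> collects these errors.
\<close>

lemma path_bound_asymptotics:
  defines "p \<equiv> \<lambda>n. nat \<lfloor>sqrt (real n)\<rfloor>"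
  shows "(\<lambda>n. (real n)\<^sup>2 / pi\<^sup>2 * path_bound (p n) (n div p n + 1)) \<longlonglongrightarrow> 1"
proof -
  define m where "m n = n div p n + 1" for n
  define \<theta> where "\<theta> n = pi / real (2 * m n + 1)" for n
  define r where "r n = real (2 * m n + 1) * real (p n) / (2 * real n)" for n
  have p_top: "filterlim (\<lambda>n. real (p n)) at_top sequentially"
    unfolding p_def by real_asymp
  have p_n: "(\<lambda>n. real (p n) / real n) \<longlonglongrightarrow> 0"
    unfolding p_def by real_asymp
  have ev: "eventually (\<lambda>n. 1 \<le> p n \<and> 1 \<le> n) sequentially"
    using filterlim_at_top[THEN iffD1, OF p_top, rule_format, of 1] eventually_ge_at_top[of 1]
    by eventually_elim auto
  have mp: "n \<le> m n * p n" "m n * p n \<le> n + p n" if "1 \<le> p n" for n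
  proof -
    have "n = n div p n * p n + n mod p n" by simp
    moreover have "n mod p n < p n" using that by simp
    ultimately show "n \<le> m n * p n" "m n * p n \<le> n + p n" unfolding m_def add_mult_distrib by linarith+
  qed
  have r_bounds: "1 \<le> r n \<and> r n \<le> 1 + 3/2 * (real (p n) / real n)" if "1 \<le> p n \<and> 1 \<le> n" for n
  proof -
    have mp': "real n \<le> real (m n) * real (p n)" "real (m n) * real (p n) \<le> real n + real (p n)"
      using mp[of n] that by (simp_all flip: of_nat_mult of_nat_add)
    have e: "real (2 * m n + 1) * real (p n) = 2 * (real (m n) * real (p n)) + real (p n)"
      by (simp add: algebra_simps)
    have "2 * real n \<le> real (2 * m n + 1) * real (p n)" unfolding e using mp' by simp
    moreover have "real (2 * m n + 1) * real (p n) \<le> 2 * real n + 3 * real (p n)" unfolding e using mp' by simp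
    ultimately have "2 * real n / (2 * real n) \<le> r n" "r n \<le> (2 * real n + 3 * real (p n)) / (2 * real n)"
      unfolding r_def by (intro divide_right_mono; simp)+
    moreover have "(2 * real n + 3 * real (p n)) / (2 * real n) = 1 + 3/2 * (real (p n) / real n)"
      using that by (simp add: field_simps)
    ultimately show ?thesis using that by simp
  qed
  have r1: "r \<longlonglongrightarrow> 1"
  proof (rule tendsto_sandwich)
    show "eventually (\<lambda>n. 1 \<le> r n) sequentially"
      using ev by eventually_elim (use r_bounds in blast)
    show "eventually (\<lambda>n. r n \<le> 1 + 3/2 * (real (p n) / real n)) sequentially"
      using ev by eventually_elim (use r_bounds in blast)
    have "(\<lambda>n. 1 + 3/2 * (real (p n) / real n)) \<longlonglongrightarrow> 1 + 3/2 * 0" by (intro tendsto_intros p_n)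
    then show "(\<lambda>n. 1 + 3/2 * (real (p n) / real n)) \<longlonglongrightarrow> 1" by simp
  qed simp
  have \<theta>_eq: "\<theta> n = pi / 2 * (real (p n) / real n) / r n" if "1 \<le> p n \<and> 1 \<le> n" for n
  proof -
    have "pi / q = pi / 2 * (P / N) / (q * P / (2 * N))" if "0 < q" "0 < P" "0 < N" for q P N :: real
      using that by (simp add: field_simps)
    from this[of "real (2 * m n + 1)" "real (p n)" "real n"] that show ?thesis
      unfolding \<theta>_def r_def by auto
  qed
  have "(\<lambda>n. pi / 2 * (real (p n) / real n) / r n) \<longlonglongrightarrow> pi / 2 * 0 / 1"
    by (intro tendsto_intros p_n r1) simp
  then have "(\<lambda>n. pi / 2 * (real (p n) / real n) / r n) \<longlonglongrightarrow> 0" by simp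
  then have "\<theta> \<longlonglongrightarrow> 0"
    by (rule Lim_transform_eventually) (use ev in eventually_elim, metis \<theta>_eq)
  then have \<theta>0: "filterlim \<theta> (at_right 0) sequentially"
    by (rule tendsto_imp_filterlim_at_right) (simp add: \<theta>_def)
  from filterlim_compose[OF cos_over_square_limit \<theta>0]
  have cos1: "(\<lambda>n. (2 - 2 * cos (\<theta> n)) / (\<theta> n)\<^sup>2) \<longlonglongrightarrow> 1" .
  have "((\<lambda>t::real. t / (t + 1)) \<longlongrightarrow> 1) at_top" by real_asymp
  from filterlim_compose[OF this p_top]
  have pp: "(\<lambda>n. real (p n) / (real (p n) + 1)) \<longlonglongrightarrow> 1" .
  have "(\<lambda>n. (2 - 2 * cos (\<theta> n)) / (\<theta> n)\<^sup>2 * (real (p n) / (real (p n) + 1)) / (r n)\<^sup>2) \<longlonglongrightarrow> 1 * 1 / 1\<^sup>2"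
    by (intro tendsto_intros cos1 pp r1) simp
  then have "(\<lambda>n. (2 - 2 * cos (\<theta> n)) / (\<theta> n)\<^sup>2 * (real (p n) / (real (p n) + 1)) / (r n)\<^sup>2) \<longlonglongrightarrow> 1"
    by simp
  then show ?thesis
  proof (rule Lim_transform_eventually)
    show "eventually (\<lambda>n. (2 - 2 * cos (\<theta> n)) / (\<theta> n)\<^sup>2 * (real (p n) / (real (p n) + 1)) / (r n)\<^sup>2 =
        (real n)\<^sup>2 / pi\<^sup>2 * path_bound (p n) (n div p n + 1)) sequentially"
      using ev
    proof eventually_elim
      case (elim n)
      define C where "C = 2 - 2 * cos (\<theta> n)"
      have "C / (pi / q)\<^sup>2 * (P / S) / (q * P / (2 * N))\<^sup>2 = N\<^sup>2 / pi\<^sup>2 * (C * 4 / (P * S))"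
        if "0 < q" "0 < P" "0 < N" "0 < S" for q P N S :: real
        using that by (simp add: field_simps power2_eq_square)
      from this[of "real (2 * m n + 1)" "real (p n)" "real n" "real (p n) + 1"] elim
      have "C / (\<theta> n)\<^sup>2 * (real (p n) / (real (p n) + 1)) / (r n)\<^sup>2 =
          (real n)\<^sup>2 / pi\<^sup>2 * (C * 4 / (real (p n) * (real (p n) + 1)))"
        unfolding \<theta>_def r_def by auto
      moreover have "path_bound (p n) (n div p n + 1) = C * 4 / (real (p n) * (real (p n) + 1))"
        by (simp add: path_bound_def C_def \<theta>_def m_def algebra_simps)
      ultimately show ?case by (simp only: C_def)
    qed
  qed
qed

lemma ladder_bound_asymptotics:
  "(\<lambda>n. (real n)\<^sup>2 / pi\<^sup>2 * (2 - 2 * cos (pi / (real n - 6)))) \<longlonglongrightarrow> 1"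
proof -
  let ?t = "\<lambda>n::nat. pi / (real n - 6)"
  have "filterlim ?t (at_right 0) sequentially" by real_asymp
  from filterlim_compose[OF cos_over_square_limit this]
  have 1: "(\<lambda>n. (2 - 2 * cos (?t n)) / (?t n)\<^sup>2) \<longlonglongrightarrow> 1" .
  have 2: "(\<lambda>n. real n / (real n - 6)) \<longlonglongrightarrow> 1" by real_asymp
  have "(\<lambda>n. (2 - 2 * cos (?t n)) / (?t n)\<^sup>2 * (real n / (real n - 6))\<^sup>2) \<longlonglongrightarrow> 1 * 1\<^sup>2"
    by (intro tendsto_intros 1 2)
  then have "(\<lambda>n. (2 - 2 * cos (?t n)) / (?t n)\<^sup>2 * (real n / (real n - 6))\<^sup>2) \<longlonglongrightarrow> 1"
    by simp
  then show ?thesis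
  proof (rule Lim_transform_eventually)
    show "\<forall>\<^sub>F n in sequentially. (2 - 2 * cos (?t n)) / (?t n)\<^sup>2 * (real n / (real n - 6))\<^sup>2 =
        (real n)\<^sup>2 / pi\<^sup>2 * (2 - 2 * cos (?t n))"
      using eventually_gt_at_top[of 6]
    proof eventually_elim
      case (elim n)
      then have "real n - 6 \<noteq> 0" by simp
      then show ?case by (simp add: power_divide)
    qed
  qed
qed

theorem theorem1p3:
  shows "(\<lambda>n::nat. (real n)\<^sup>2 / pi\<^sup>2 * min_algebraic_connectivity n) \<longlonglongrightarrow> 1"
proof (rule tendsto_sandwich)
  define p where "p n = nat \<lfloor>sqrt (real n)\<rfloor>" for n
  show "(\<lambda>n. (real n)\<^sup>2 / pi\<^sup>2 * path_bound (p n) (n div p n + 1)) \<longlonglongrightarrow> 1"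
    unfolding p_def by (rule path_bound_asymptotics)
  show "(\<lambda>n. (real n)\<^sup>2 / pi\<^sup>2 * (2 - 2 * cos (pi / (real n - 6)))) \<longlonglongrightarrow> 1"
    by (rule ladder_bound_asymptotics)
  have nonempty: "capped_ladder n \<in> connected_cubic_bipartite_graphs (2 * n)" if "8 \<le> n" for n
    using that by (intro capped_ladder_mem) simp
  show "\<forall>\<^sub>F n in sequentially. (real n)\<^sup>2 / pi\<^sup>2 * path_bound (p n) (n div p n + 1)
      \<le> (real n)\<^sup>2 / pi\<^sup>2 * min_algebraic_connectivity n"
    using eventually_ge_at_top[of 8]
  proof eventually_elim
    case (elim n)
    have "1 \<le> sqrt (real n)" using elim by simp
    then have p: "1 \<le> p n" unfolding p_def by (simp add: le_nat_iff le_floor_iff)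
    have "n \<le> (n div p n + 1) * p n"
      using p dividend_less_div_times[of "p n" n] by simp
    then have "path_bound (p n) (n div p n + 1) \<le> algebraic_connectivity G"
      if "G \<in> connected_cubic_bipartite_graphs (2 * n)" for G
      using that elim p by (intro algebraic_connectivity_ge) auto
    then have "path_bound (p n) (n div p n + 1) \<le> min_algebraic_connectivity n"
      unfolding min_algebraic_connectivity_def
      using finite_connected_cubic_bipartite_graphs nonempty[OF elim] by (subst Min_ge_iff) auto
    then show ?case by (intro mult_left_mono) auto
  qed
  show "\<forall>\<^sub>F n in sequentially. (real n)\<^sup>2 / pi\<^sup>2 * min_algebraic_connectivity n
      \<le> (real n)\<^sup>2 / pi\<^sup>2 * (2 - 2 * cos (pi / (real n - 6)))"
    using eventually_ge_at_top[of 8]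
  proof eventually_elim
    case (elim n)
    have "min_algebraic_connectivity n \<le> algebraic_connectivity (capped_ladder n)"
      unfolding min_algebraic_connectivity_def
      using finite_connected_cubic_bipartite_graphs nonempty[OF elim] by (intro Min_le) auto
    also have "\<dots> \<le> 2 - 2 * cos (pi / (real n - 6))"
      using algebraic_connectivity_capped_ladder_le[OF elim] elim by (simp add: of_nat_diff)
    finally show ?case by (intro mult_left_mono) auto
  qed
qed

end
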